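(* Let $A$ and $B$ be connected graded $\mathbb K$-algebras and let $t:(B\otimes A)_{\le n}\to(A\otimes B)_{\le n}$ be a $\mathbb K$-linear map that is graded twisting to degree $n$. There exists a $\mathbb K$-linear extension $t':(B\otimes A)_{\le n+1}\to(A\otimes B)_{\le n+1}$ of $t$ that is graded twisting to degree $n+1$ if and only if there exists a $\mathbb K$-linear map $f:(B_+\otimes A_+)_{n+1}\to(A\otimes B)_{n+1}$ satisfying $f\delta_{n+1}=R_{n+1}$, where $\delta$ and $R$ are the maps associated to $t$ defined in the context. If such an extension $t'$ exists, it is unique if and only if $\delta_{n+1}$ is surjective (onto $(B_+\otimes A_+)_{n+1}$).
   Context: $\mathbb K$ is a field, $\otimes=\otimes_{\mathbb K}$. Graded means $\mathbb N$-graded; algebras are associative and unital; connected means $A_0=\mathbb K1_A$; $A_+=\bigoplus_{i>0}A_i$. $\mu_A$ is the multiplication of $A$; $1_A$ also denotes the identity map of $A$. Tensor products of graded spaces are graded by $(V\otimes W)_m=\bigoplus_{k+l=m}V_k\otimes W_l$. A linear map is graded if it preserves degree; $f_n$ is its degree $n$ component, $f_{\le n}=\bigoplus_{i\le n}f_i$. A graded linear map $t:(B\otimes A)_{\le n}\to(A\otimes B)_{\le n}$ is graded twisting to degree $n$ if for each $i\le n$: $t(1_B\otimes a)=a\otimes 1_B$, $t(b\otimes 1_A)=1_A\otimes b$ for $a\in A_i$, $b\in B_i$, and $t_i(\mu_B\otimes\mu_A)=(\mu_A\otimes\mu_B)(1_A\otimes t_{\le i}\otimes 1_B)(t_{\le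 i}\otimes t_{\le i})(1_B\otimes t_{\le i}\otimes 1_A)$ on $(B\otimes B\otimes A\otimes A)_i$. Let $\pi^A:(A\otimes B)_{\le n}\to\bigoplus_{i\le n}A_i\otimes B_0\cong A_{\le n}$ and $\pi^B:(A\otimes B)_{\le n}\to\bigoplus_{i\le n}A_0\otimes B_i\cong B_{\le n}$ be the canonical projections, $t^A=\pi^A t$, $t^B=\pi^B t$, and let $i_A:A\to A\otimes B$, $i_B:B\to A\otimes B$ be the canonical inclusions $a\mapsto a\otimes 1$, $b\mapsto 1\otimes b$. Define linear maps on $(B_+\otimes A_+\otimes A_+)_{\le n+1}\oplus(B_+\otimes B_+\otimes A_+)_{\le n+1}$ (each given by the sum of its two indicated maps on the two summands): $$\delta=(1_B\otimes\mu_A-t^B\otimes 1_A)\oplus(\mu_B\otimes 1_A-1_B\otimes t^A),$$ with values in $(B_+\otimes A_+)_{\le n+1}$, and $$R=(\mu_A\otimes 1_B)(1_A\otimes t)((t-i_Bt^B)\otimes 1_A)\ \oplus\ (1_A\otimes\mu_B)(t\otimes 1_B)(1_B\otimes(t-i_At^A)),$$ with values in $(A\otimes B)_{\le n+1}$. $\delta_{n+1}$, $R_{n+1}$ are their degree $n+1$ components. *)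

theory Defs
  imports Complex_Main "HOL-Library.Poly_Mapping"
begin

section \<open>Tensor product of vector spaces\<close>

text \<open>The free vector space on a set of generators is the type \<open>'x \<Rightarrow>\<^sub>0 'k\<close> of finitely supported
  functions, with the following scalar multiplication.\<close>

definition fscale :: "'k::field \<Rightarrow> ('x \<Rightarrow>\<^sub>0 'k) \<Rightarrow> ('x \<Rightarrow>\<^sub>0 'k)"
  where "fscale c x = Poly_Mapping.map (\<lambda>d. c * d) x"

abbreviation gen :: "'v \<Rightarrow> 'w \<Rightarrow> (('v \<times> 'w) \<Rightarrow>\<^sub>0 'k::field)"
  where "gen v w \<equiv> Poly_Mapping.single (v, w) 1"

definition tensor_relations ::
    "('k::field \<Rightarrow> 'v::ab_group_add \<Rightarrow> 'v) \<Rightarrow> ('k \<Rightarrow> 'w::ab_group_add \<Rightarrow> 'w) \<Rightarrow> (('v \<times> 'w) \<Rightarrow>\<^sub>0 'k) set"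
  where "tensor_relations sV sW = module.span fscale
    ({gen (v + v') w - gen v w - gen v' w | v v' w. True} \<union>
     {gen v (w + w') - gen v w - gen v w' | v w w'. True} \<union>
     {gen (sV c v) w - fscale c (gen v w) | c v w. True} \<union>
     {gen v (sW c w) - fscale c (gen v w) | c v w. True})"

text \<open>The quotient of the free vector space on \<open>'v \<times> 'w\<close> by the bilinear relations depends on the
  scalar multiplications, so it cannot be a type of its own. It is realised inside the free vector
  space, as a linear complement of the relations: the quotient map is an idempotent linear map whose
  kernel is the span of the relations, and the class of the generator \<open>(v, w)\<close> is its image under
  this map. The theorems \<open>tensor_lift\<close> and \<open>tensor_lift_unique\<close> below give the universal property.\<close>

definition quotient_map ::
    "('k::field \<Rightarrow> 'v::ab_group_add \<Rightarrow> 'v) \<Rightarrow> ('k \<Rightarrow> 'w::ab_group_add \<Rightarrow> 'w)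
      \<Rightarrow> (('v \<times> 'w) \<Rightarrow>\<^sub>0 'k) \<Rightarrow> (('v \<times> 'w) \<Rightarrow>\<^sub>0 'k)"
  where "quotient_map sV sW = (SOME p. Vector_Spaces.linear fscale fscale p \<and>
    (\<forall>x. p (p x) = p x) \<and> {x. p x = 0} = tensor_relations sV sW)"


section \<open>Graded vector spaces\<close>

text \<open>A graded vector space consists of a scalar multiplication on an ambient type and of subspaces
  \<open>deg V i\<close>. Its underlying vector space is their sum \<open>carrier V\<close>, possibly a proper subspace of the
  ambient type.\<close>

record ('k, 'v) gspace =
  scl :: "'k \<Rightarrow> 'v \<Rightarrow> 'v"
  deg :: "nat \<Rightarrow> 'v set"

definition carrier :: "('k::field, 'v::ab_group_add) gspace \<Rightarrow> 'v set"
  where "carrier V = module.span (scl V) (\<Union>i. deg V i)"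

definition pos :: "('k, 'v::zero) gspace \<Rightarrow> ('k, 'v) gspace"
  where "pos V = V\<lparr>deg := (\<lambda>i. if i = 0 then {0} else deg V i)\<rparr>"

definition trunc :: "nat \<Rightarrow> ('k, 'v::zero) gspace \<Rightarrow> ('k, 'v) gspace"
  where "trunc n V = V\<lparr>deg := (\<lambda>i. if i \<le> n then deg V i else {0})\<rparr>"

definition tens :: "('k::field, 'v::ab_group_add) gspace \<Rightarrow> ('k, 'w::ab_group_add) gspace
    \<Rightarrow> 'v \<Rightarrow> 'w \<Rightarrow> (('v \<times> 'w) \<Rightarrow>\<^sub>0 'k)"
  where "tens V W v w = quotient_map (scl V) (scl W) (gen v w)"

definition gtensor :: "('k::field, 'v::ab_group_add) gspace \<Rightarrow> ('k, 'w::ab_group_add) gspace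
    \<Rightarrow> ('k, ('v \<times> 'w) \<Rightarrow>\<^sub>0 'k) gspace"  (infixr "\<otimes>" 70)
  where "V \<otimes> W = \<lparr>scl = fscale,
    deg = (\<lambda>m. module.span fscale {tens V W v w | k l v w. k + l = m \<and> v \<in> deg V k \<and> w \<in> deg W l})\<rparr>"

definition linear_on ::
    "('k \<Rightarrow> 'v::ab_group_add \<Rightarrow> 'v) \<Rightarrow> ('k \<Rightarrow> 'w::ab_group_add \<Rightarrow> 'w) \<Rightarrow> 'v set \<Rightarrow> ('v \<Rightarrow> 'w) \<Rightarrow> bool"
  where "linear_on sV sW S f \<longleftrightarrow>
    (\<forall>x\<in>S. \<forall>y\<in>S. f (x + y) = f x + f y) \<and> (\<forall>c. \<forall>x\<in>S. f (sV c x) = sW c (f x))"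

definition graded_linear ::
    "('k::field, 'v::ab_group_add) gspace \<Rightarrow> ('k, 'w::ab_group_add) gspace \<Rightarrow> ('v \<Rightarrow> 'w) \<Rightarrow> bool"
  where "graded_linear V W f \<longleftrightarrow>
    linear_on (scl V) (scl W) (carrier V) f \<and> (\<forall>i. f ` deg V i \<subseteq> deg W i)"

text \<open>The linear map on \<open>V \<otimes> W\<close> induced by a bilinear map \<open>g\<close>. Values outside the carrier of
  \<open>V \<otimes> W\<close> are irrelevant.\<close>

definition lift :: "('k::field, 'v::ab_group_add) gspace \<Rightarrow> ('k, 'w::ab_group_add) gspace
    \<Rightarrow> ('k \<Rightarrow> 'u::ab_group_add \<Rightarrow> 'u) \<Rightarrow> ('v \<Rightarrow> 'w \<Rightarrow> 'u) \<Rightarrow> (('v \<times> 'w) \<Rightarrow>\<^sub>0 'k) \<Rightarrow> 'u"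
  where "lift V W sU g = (SOME h. linear_on fscale sU (carrier (V \<otimes> W)) h \<and>
    (\<forall>v\<in>carrier V. \<forall>w\<in>carrier W. h (tens V W v w) = g v w))"

text \<open>\<open>tmap V W V' W' f g\<close> is the map \<open>f \<otimes> g : V \<otimes> W \<rightarrow> V' \<otimes> W'\<close>, for linear maps \<open>f : V \<rightarrow> V'\<close> and
  \<open>g : W \<rightarrow> W'\<close>.\<close>

definition tmap where
  "tmap V W V' W' f g = lift V W fscale (\<lambda>v w. tens V' W' (f v) (g w))"

text \<open>The associativity isomorphisms between \<open>U \<otimes> (V \<otimes> W)\<close> and \<open>(U \<otimes> V) \<otimes> W\<close>. The mathematical
  text leaves them implicit.\<close>

definition assoc_l where
  "assoc_l U V W = lift U (V \<otimes> W) fscale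
     (\<lambda>u. lift V W fscale (\<lambda>v w. tens (U \<otimes> V) W (tens U V u v) w))"

definition assoc_r where
  "assoc_r U V W = lift (U \<otimes> V) W fscale
     (\<lambda>x w. lift U V fscale (\<lambda>u v. tens U (V \<otimes> W) u (tens V W v w)) x)"

text \<open>For \<open>f : V \<otimes> W \<rightarrow> V' \<otimes> W'\<close>, the map \<open>1 \<otimes> f \<otimes> 1\<close> from \<open>(U \<otimes> V) \<otimes> (W \<otimes> X)\<close> to
  \<open>(U \<otimes> V') \<otimes> (W' \<otimes> X)\<close>. The argument \<open>D\<close> is the domain of \<open>f\<close>, a graded subspace of \<open>V \<otimes> W\<close>.\<close>

definition inner_map where
  "inner_map U V W D V' W' X f x =
    (let y = tmap U (V \<otimes> W \<otimes> X) U ((V \<otimes> W) \<otimes> X) (\<lambda>u. u) (assoc_l V W X) (assoc_r U V (W \<otimes> X) x);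
         z = tmap U (D \<otimes> X) U ((V' \<otimes> W') \<otimes> X) (\<lambda>u. u)
               (tmap D X (V' \<otimes> W') X f (\<lambda>u. u)) y
     in assoc_l U V' (W' \<otimes> X)
          (tmap U ((V' \<otimes> W') \<otimes> X) U (V' \<otimes> W' \<otimes> X) (\<lambda>u. u) (assoc_r V' W' X) z))"


section \<open>Connected graded algebras and graded twisting maps\<close>

text \<open>The type class \<^class>\<open>ring_1\<close> includes \<open>0 \<noteq> 1\<close>: a connected algebra has \<open>A\<^sub>0 = \<K>1 \<cong> \<K>\<close>.\<close>

locale connected_graded_algebra = vector_space "scl A"
  for A :: "('k::field, 'a::ring_1) gspace" +
  assumes scl_mult_left: "scl A c x * y = scl A c (x * y)"
    and scl_mult_right: "x * scl A c y = scl A c (x * y)"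
    and subspace_deg: "module.subspace (scl A) (deg A i)"
    and direct_sum: "\<exists>!f. finite {i. f i \<noteq> 0} \<and> (\<forall>i. f i \<in> deg A i) \<and> x = (\<Sum>i | f i \<noteq> 0. f i)"
    and one_deg: "1 \<in> deg A 0"
    and mult_deg: "x \<in> deg A i \<Longrightarrow> y \<in> deg A j \<Longrightarrow> x * y \<in> deg A (i + j)"
    and connected: "deg A 0 = {scl A c 1 | c. True}"

definition mu :: "('k::field, 'a::ring_1) gspace \<Rightarrow> (('a \<times> 'a) \<Rightarrow>\<^sub>0 'k) \<Rightarrow> 'a"
  where "mu A = lift A A (scl A) (*)"

definition graded_twisting ::
    "('k::field, 'a::ring_1) gspace \<Rightarrow> ('k, 'b::ring_1) gspace \<Rightarrow> nat
      \<Rightarrow> ((('b \<times> 'a) \<Rightarrow>\<^sub>0 'k) \<Rightarrow> (('a \<times> 'b) \<Rightarrow>\<^sub>0 'k)) \<Rightarrow> bool"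
  where "graded_twisting A B n t \<longleftrightarrow>
    graded_linear (trunc n (B \<otimes> A)) (trunc n (A \<otimes> B)) t \<and>
    (\<forall>i\<le>n. let D = trunc i (B \<otimes> A) in
      (\<forall>a\<in>deg A i. t (tens B A 1 a) = tens A B a 1) \<and>
      (\<forall>b\<in>deg B i. t (tens B A b 1) = tens A B 1 b) \<and>
      (\<forall>x\<in>deg ((B \<otimes> B) \<otimes> (A \<otimes> A)) i.
         t (tmap (B \<otimes> B) (A \<otimes> A) B A (mu B) (mu A) x) =
         tmap (A \<otimes> A) (B \<otimes> B) A B (mu A) (mu B)
           (inner_map A B A D A B B t
             (tmap D D (A \<otimes> B) (A \<otimes> B) t t
               (inner_map B B A D A B A t x)))))"

text \<open>The projections of \<open>A \<otimes> B\<close> onto \<open>A \<otimes> B\<^sub>0 \<cong> A\<close> along \<open>A \<otimes> B\<^sub>+\<close> and onto \<open>A\<^sub>0 \<otimes> B \<cong> B\<close> along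
  \<open>A\<^sub>+ \<otimes> B\<close>.\<close>

definition proj_A :: "('k::field, 'a::ring_1) gspace \<Rightarrow> ('k, 'b::ring_1) gspace
    \<Rightarrow> (('a \<times> 'b) \<Rightarrow>\<^sub>0 'k) \<Rightarrow> 'a"
  where "proj_A A B x = (THE a. x - tens A B a 1 \<in> carrier (A \<otimes> pos B))"

definition proj_B :: "('k::field, 'a::ring_1) gspace \<Rightarrow> ('k, 'b::ring_1) gspace
    \<Rightarrow> (('a \<times> 'b) \<Rightarrow>\<^sub>0 'k) \<Rightarrow> 'b"
  where "proj_B A B x = (THE b. x - tens A B 1 b \<in> carrier (pos A \<otimes> B))"

text \<open>The maps \<open>\<delta>\<close> and \<open>R\<close> associated with \<open>t : (B \<otimes> A)\<^sub>\<le>\<^sub>n \<rightarrow> (A \<otimes> B)\<^sub>\<le>\<^sub>n\<close>. An element of the direct sum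
  \<open>(B\<^sub>+ \<otimes> A\<^sub>+ \<otimes> A\<^sub>+)\<^sub>m \<oplus> (B\<^sub>+ \<otimes> B\<^sub>+ \<otimes> A\<^sub>+)\<^sub>m\<close> is a pair.\<close>

definition delta_domain where
  "delta_domain A B m = deg (pos B \<otimes> pos A \<otimes> pos A) m \<times> deg (pos B \<otimes> pos B \<otimes> pos A) m"

definition delta ::
    "('k::field, 'a::ring_1) gspace \<Rightarrow> ('k, 'b::ring_1) gspace \<Rightarrow> nat
      \<Rightarrow> ((('b \<times> 'a) \<Rightarrow>\<^sub>0 'k) \<Rightarrow> (('a \<times> 'b) \<Rightarrow>\<^sub>0 'k))
      \<Rightarrow> (('b \<times> (('a \<times> 'a) \<Rightarrow>\<^sub>0 'k)) \<Rightarrow>\<^sub>0 'k) \<times> (('b \<times> (('b \<times> 'a) \<Rightarrow>\<^sub>0 'k)) \<Rightarrow>\<^sub>0 'k)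
      \<Rightarrow> (('b \<times> 'a) \<Rightarrow>\<^sub>0 'k)"
  where "delta A B n t = (\<lambda>(x, y).
    (let D = trunc n (B \<otimes> A); tA = (\<lambda>z. proj_A A B (t z)); tB = (\<lambda>z. proj_B A B (t z)) in
      (tmap B (A \<otimes> A) B A (\<lambda>b. b) (mu A) x - tmap D A B A tB (\<lambda>a. a) (assoc_l B A A x)) +
      (tmap (B \<otimes> B) A B A (mu B) (\<lambda>a. a) (assoc_l B B A y) - tmap B D B A (\<lambda>b. b) tA y)))"

definition Rmap ::
    "('k::field, 'a::ring_1) gspace \<Rightarrow> ('k, 'b::ring_1) gspace \<Rightarrow> nat
      \<Rightarrow> ((('b \<times> 'a) \<Rightarrow>\<^sub>0 'k) \<Rightarrow> (('a \<times> 'b) \<Rightarrow>\<^sub>0 'k))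
      \<Rightarrow> (('b \<times> (('a \<times> 'a) \<Rightarrow>\<^sub>0 'k)) \<Rightarrow>\<^sub>0 'k) \<times> (('b \<times> (('b \<times> 'a) \<Rightarrow>\<^sub>0 'k)) \<Rightarrow>\<^sub>0 'k)
      \<Rightarrow> (('a \<times> 'b) \<Rightarrow>\<^sub>0 'k)"
  where "Rmap A B n t = (\<lambda>(x, y).
    (let D = trunc n (B \<otimes> A); E = A \<otimes> B;
         u = (\<lambda>z. t z - tens A B 1 (proj_B A B (t z)));
         v = (\<lambda>z. t z - tens A B (proj_A A B (t z)) 1) in
      tmap (A \<otimes> A) B A B (mu A) (\<lambda>b. b) (assoc_l A A B
        (tmap A D A E (\<lambda>a. a) t (assoc_r A B A
          (tmap D A E A u (\<lambda>a. a) (assoc_l B A A x))))) +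
      tmap A (B \<otimes> B) A B (\<lambda>a. a) (mu B) (assoc_r A B B
        (tmap D B E B t (\<lambda>b. b) (assoc_l B A B
          (tmap B D B E (\<lambda>b. b) v y))))))"

text \<open>A linear map defined on a subspace is represented by a function on the ambient type, so
  extension and equality of such maps mean agreement on the subspace.\<close>

definition twisting_extension where
  "twisting_extension A B n t t' \<longleftrightarrow>
    graded_twisting A B (Suc n) t' \<and> (\<forall>x\<in>carrier (trunc n (B \<otimes> A)). t' x = t x)"


section \<open>The universal property\<close>

lemma lookup_fscale [simp]: "Poly_Mapping.lookup (fscale c x) p = c * Poly_Mapping.lookup x p"
  by (simp add: fscale_def Poly_Mapping.map.rep_eq when_def)

lemma vector_space_fscale: "vector_space fscale"
  by unfold_locales (auto intro!: poly_mapping_eqI simp: lookup_add algebra_simps)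

interpretation free: vector_space fscale
  by (rule vector_space_fscale)

lemma quotient_map:
  "Vector_Spaces.linear fscale fscale (quotient_map sV sW)"
  "quotient_map sV sW (quotient_map sV sW x) = quotient_map sV sW x"
  "quotient_map sV sW x = 0 \<longleftrightarrow> x \<in> tensor_relations sV sW"
proof -
  let ?N = "tensor_relations sV sW"
  interpret vp: vector_space_pair fscale fscale
    by unfold_locales
  have sub: "free.subspace ?N"
    unfolding tensor_relations_def by (rule free.subspace_span)
  have "\<exists>g. g ` UNIV \<subseteq> ?N \<and> Vector_Spaces.linear fscale fscale g \<and> (\<forall>v\<in>?N. g (id v) = v)"
    by (rule vp.linear_exists_left_inverse_on[OF free.linear_id sub]) auto
  then obtain g where g: "range g \<subseteq> ?N" "Vector_Spaces.linear fscale fscale g"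
      "\<And>v. v \<in> ?N \<Longrightarrow> g v = v"
    by auto
  let ?p = "\<lambda>x. x - g x"
  have "Vector_Spaces.linear fscale fscale ?p"
    by (rule vp.linear_compose_sub[OF free.linear_ident g(2)])
  moreover have "g (?p x) = 0" for x
    using g(1) g(3)[of "g x"] vp.linear_diff[OF g(2), of x "g x"] by (auto simp: image_subset_iff)
  then have "?p (?p x) = ?p x" for x by simp
  moreover have "{x. ?p x = 0} = ?N"
    using g(1,3) by (auto simp: image_subset_iff) metis
  ultimately have "\<exists>p. Vector_Spaces.linear fscale fscale p \<and>
    (\<forall>x. p (p x) = p x) \<and> {x. p x = 0} = ?N" by blast
  from someI_ex[OF this]
  have "Vector_Spaces.linear fscale fscale (quotient_map sV sW) \<and>
    (\<forall>x. quotient_map sV sW (quotient_map sV sW x) = quotient_map sV sW x) \<and>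
    {x. quotient_map sV sW x = 0} = ?N"
    unfolding quotient_map_def .
  then show "Vector_Spaces.linear fscale fscale (quotient_map sV sW)"
    "quotient_map sV sW (quotient_map sV sW x) = quotient_map sV sW x"
    "quotient_map sV sW x = 0 \<longleftrightarrow> x \<in> ?N"
    by blast+
qed

lemma quotient_map_diff: "quotient_map sV sW (x - y) = quotient_map sV sW x - quotient_map sV sW y"
proof -
  interpret vp: vector_space_pair fscale fscale by unfold_locales
  show ?thesis by (rule vp.linear_diff[OF quotient_map(1)])
qed

lemma quotient_map_scale: "quotient_map sV sW (fscale c x) = fscale c (quotient_map sV sW x)"
proof -
  interpret vp: vector_space_pair fscale fscale by unfold_locales
  show ?thesis by (rule vp.linear_scale[OF quotient_map(1)])
qed

lemma tens_bilinear:
  "tens V W (v + v') w = tens V W v w + tens V W v' w"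
  "tens V W v (w + w') = tens V W v w + tens V W v w'"
  "tens V W (scl V c v) w = fscale c (tens V W v w)"
  "tens V W v (scl W c w) = fscale c (tens V W v w)"
proof -
  let ?N = "tensor_relations (scl V) (scl W)"
  have "gen (v + v') w - gen v w - gen v' w \<in> ?N" "gen v (w + w') - gen v w - gen v w' \<in> ?N"
    "gen (scl V c v) w - fscale c (gen v w) \<in> ?N" "gen v (scl W c w) - fscale c (gen v w) \<in> ?N"
    unfolding tensor_relations_def by (rule free.span_base; blast)+
  then show "tens V W (v + v') w = tens V W v w + tens V W v' w"
    "tens V W v (w + w') = tens V W v w + tens V W v w'"
    "tens V W (scl V c v) w = fscale c (tens V W v w)"
    "tens V W v (scl W c w) = fscale c (tens V W v w)"
    unfolding quotient_map(3)[symmetric] tens_def quotient_map_diff quotient_map_scale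
    by (simp_all add: algebra_simps)
qed

lemma tens_in_carrier:
  assumes "vector_space (scl V)" "vector_space (scl W)" "v \<in> carrier V" "w \<in> carrier W"
  shows "tens V W v w \<in> carrier (V \<otimes> W)"
proof -
  interpret V: vector_space "scl V" by fact
  interpret W: vector_space "scl W" by fact
  have s: "scl (V \<otimes> W) = fscale" by (simp add: gtensor_def)
  have sub: "free.subspace (carrier (V \<otimes> W))"
    unfolding carrier_def s by (rule free.subspace_span)
  have z: "tens V W 0 w' = 0" "tens V W v' 0 = 0" for v' w'
    using tens_bilinear(1)[of V W 0 0 w'] tens_bilinear(2)[of V W v' 0 0] by simp_all
  have hom: "tens V W x y \<in> carrier (V \<otimes> W)" if "x \<in> deg V i" "y \<in> deg W j" for x y i j
  proof -
    have "tens V W x y \<in> deg (V \<otimes> W) (i + j)"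
      unfolding gtensor_def using that by (auto intro!: free.span_base)
    then show ?thesis
      unfolding carrier_def s by (auto intro!: free.span_base)
  qed
  have *: "tens V W x w \<in> carrier (V \<otimes> W)" if x: "x \<in> deg V i" for x i
    using assms(4) unfolding carrier_def[of W]
  proof (induction rule: W.span_induct_alt)
    case base then show ?case using free.subspace_0[OF sub] by (simp add: z)
  next
    case (step c a b) then show ?case using hom[OF x]
      by (auto simp: tens_bilinear intro!: free.subspace_add[OF sub] free.subspace_scale[OF sub])
  qed
  show ?thesis
    using assms(3) unfolding carrier_def[of V]
  proof (induction rule: V.span_induct_alt)
    case base then show ?case using free.subspace_0[OF sub] by (simp add: z)
  next
    case (step c a b) then show ?case using *
      by (auto simp: tens_bilinear intro!: free.subspace_add[OF sub] free.subspace_scale[OF sub])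
  qed
qed

theorem tensor_lift_unique:
  assumes "vector_space (scl V)" "vector_space (scl W)" "vector_space sU"
    and h: "linear_on fscale sU (carrier (V \<otimes> W)) h" "linear_on fscale sU (carrier (V \<otimes> W)) h'"
    and eq: "\<And>v w. v \<in> carrier V \<Longrightarrow> w \<in> carrier W \<Longrightarrow> h (tens V W v w) = h' (tens V W v w)"
    and x: "x \<in> carrier (V \<otimes> W)"
  shows "h x = h' x"
proof -
  interpret V: vector_space "scl V" by fact
  interpret W: vector_space "scl W" by fact
  interpret U: vector_space sU by fact
  have s: "scl (V \<otimes> W) = fscale" by (simp add: gtensor_def)
  let ?C = "carrier (V \<otimes> W)"
  have sub: "free.subspace ?C"
    unfolding carrier_def s by (rule free.subspace_span)
  have "free.subspace {x \<in> ?C. h x = h' x}"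
  proof (rule free.subspaceI)
    have "h (fscale 0 0) = sU 0 (h 0)" "h' (fscale 0 0) = sU 0 (h' 0)"
      using h free.subspace_0[OF sub] unfolding linear_on_def by blast+
    then show "0 \<in> {x \<in> ?C. h x = h' x}"
      using free.subspace_0[OF sub] by simp
  next
    fix x y assume "x \<in> {x \<in> ?C. h x = h' x}" "y \<in> {x \<in> ?C. h x = h' x}"
    then show "x + y \<in> {x \<in> ?C. h x = h' x}"
      using h free.subspace_add[OF sub] by (simp add: linear_on_def)
  next
    fix c x assume "x \<in> {x \<in> ?C. h x = h' x}"
    then show "fscale c x \<in> {x \<in> ?C. h x = h' x}"
      using h free.subspace_scale[OF sub] by (simp add: linear_on_def)
  qed
  moreover have "deg (V \<otimes> W) m \<subseteq> {x \<in> ?C. h x = h' x}" for m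
  proof -
    have "{tens V W v w | k l v w. k + l = m \<and> v \<in> deg V k \<and> w \<in> deg W l}
        \<subseteq> {x \<in> ?C. h x = h' x}"
    proof clarify
      fix k l v w assume "v \<in> deg V k" "w \<in> deg W l"
      then have "v \<in> carrier V" "w \<in> carrier W"
        by (auto simp: carrier_def intro: V.span_base W.span_base)
      then show "tens V W v w \<in> ?C \<and> h (tens V W v w) = h' (tens V W v w)"
        using eq tens_in_carrier[OF assms(1,2)] by blast
    qed
    then show ?thesis
      using calculation by (simp add: gtensor_def free.span_minimal)
  qed
  ultimately have "?C \<subseteq> {x \<in> ?C. h x = h' x}"
    unfolding carrier_def[of "V \<otimes> W"] s by (intro free.span_minimal) auto
  then show ?thesis using x by blast
qed

theorem tensor_lift:
  assumes "vector_space (scl V)" "vector_space (scl W)" "vector_space sU"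
    and left: "\<And>w. w \<in> carrier W \<Longrightarrow> linear_on (scl V) sU (carrier V) (\<lambda>v. g v w)"
    and right: "\<And>v. v \<in> carrier V \<Longrightarrow> linear_on (scl W) sU (carrier W) (g v)"
  shows "linear_on fscale sU (carrier (V \<otimes> W)) (lift V W sU g)"
    and "\<And>v w. v \<in> carrier V \<Longrightarrow> w \<in> carrier W \<Longrightarrow> lift V W sU g (tens V W v w) = g v w"
proof -
  interpret V: vector_space "scl V" by fact
  interpret W: vector_space "scl W" by fact
  interpret U: vector_space sU by fact
  interpret VV: vector_space_pair "scl V" "scl V" by unfold_locales
  interpret WW: vector_space_pair "scl W" "scl W" by unfold_locales
  interpret FU: vector_space_pair fscale sU by unfold_locales
  have subV: "V.subspace (carrier V)" and subW: "W.subspace (carrier W)"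
    unfolding carrier_def by simp_all
  have "\<exists>p. p ` UNIV \<subseteq> carrier V \<and> Vector_Spaces.linear (scl V) (scl V) p \<and> (\<forall>v\<in>carrier V. p (id v) = v)"
    by (rule VV.linear_exists_left_inverse_on[OF V.linear_id subV]) auto
  then obtain p where p: "\<And>x. p x \<in> carrier V" "Vector_Spaces.linear (scl V) (scl V) p"
      "\<And>v. v \<in> carrier V \<Longrightarrow> p v = v" by auto
  have "\<exists>q. q ` UNIV \<subseteq> carrier W \<and> Vector_Spaces.linear (scl W) (scl W) q \<and> (\<forall>v\<in>carrier W. q (id v) = v)"
    by (rule WW.linear_exists_left_inverse_on[OF W.linear_id subW]) auto
  then obtain q where q: "\<And>x. q x \<in> carrier W" "Vector_Spaces.linear (scl W) (scl W) q"
      "\<And>v. v \<in> carrier W \<Longrightarrow> q v = v" by auto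
  define G where "G = (\<lambda>(v, w). g (p v) (q w))"
  have G: "G (v + v', w) = G (v, w) + G (v', w)" "G (v, w + w') = G (v, w) + G (v, w')"
      "G (scl V c v, w) = sU c (G (v, w))" "G (v, scl W c w) = sU c (G (v, w))" for v v' w w' c
    using left[OF q(1)] right[OF p(1)] p(1) q(1)
    by (auto simp: G_def linear_on_def VV.linear_add[OF p(2)] VV.linear_scale[OF p(2)]
        WW.linear_add[OF q(2)] WW.linear_scale[OF q(2)])
  define B :: "(('b \<times> 'c) \<Rightarrow>\<^sub>0 'a) set" where "B = range (\<lambda>z. Poly_Mapping.single z 1)"
  have rep: "(\<Sum>b\<in>T. fscale (c b) b) = 0 \<Longrightarrow> b \<in> T \<Longrightarrow> c b = 0"
    if T: "finite T" "T \<subseteq> B" for T c b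
  proof -
    assume sum0: "(\<Sum>b\<in>T. fscale (c b) b) = 0" and b: "b \<in> T"
    obtain z where z: "b = Poly_Mapping.single z 1" using T b by (auto simp: B_def)
    have "(\<Sum>b'\<in>T. c b' * Poly_Mapping.lookup b' z) = Poly_Mapping.lookup (\<Sum>b\<in>T. fscale (c b) b) z"
      by (simp add: lookup_sum)
    also have "\<dots> = 0" by (simp add: sum0)
    also have "(\<Sum>b'\<in>T. c b' * Poly_Mapping.lookup b' z) = (\<Sum>b'\<in>T. if b' = b then c b' else 0)"
    proof (rule sum.cong)
      fix b' assume "b' \<in> T"
      then obtain z' where "b' = Poly_Mapping.single z' 1" using T(2) by (auto simp: B_def)
      then show "c b' * Poly_Mapping.lookup b' z = (if b' = b then c b' else 0)"
        by (cases "z' = z") (auto simp: z lookup_single when_def dest: arg_cong[where f = Poly_Mapping.keys])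
    qed simp
    also have "\<dots> = c b" using T(1) b by simp
    finally show "c b = 0" .
  qed
  have indep: "free.independent B"
    unfolding free.dependent_explicit using rep by blast
  obtain H where H: "Vector_Spaces.linear fscale sU H"
      "\<And>b. b \<in> B \<Longrightarrow> H b = G (the_elem (Poly_Mapping.keys b))"
    using FU.linear_independent_extend[OF indep, of "\<lambda>b. G (the_elem (Poly_Mapping.keys b))"] by blast
  have Hgen: "H (gen v w) = G (v, w)" for v w
    using H(2)[of "gen v w"] by (auto simp: B_def)
  have "tensor_relations (scl V) (scl W) \<subseteq> {x. H x = 0}"
    unfolding tensor_relations_def
    by (rule free.span_minimal)
      (auto simp: FU.linear_diff[OF H(1)] FU.linear_scale[OF H(1)] Hgen G
        intro!: FU.linear_subspace_kernel[OF H(1)])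
  then have "H (x - quotient_map (scl V) (scl W) x) = 0" for x
    using quotient_map(3)[of "scl V" "scl W" "x - quotient_map (scl V) (scl W) x"]
    by (auto simp: quotient_map_diff quotient_map(2))
  then have "H (quotient_map (scl V) (scl W) x) = H x" for x
    by (simp add: FU.linear_diff[OF H(1)])
  then have Htens: "H (tens V W v w) = g v w" if "v \<in> carrier V" "w \<in> carrier W" for v w
    using that by (simp add: tens_def Hgen G_def p(3) q(3))
  have "linear_on fscale sU (carrier (V \<otimes> W)) H"
    by (simp add: linear_on_def FU.linear_add[OF H(1)] FU.linear_scale[OF H(1)])
  with Htens have "\<exists>h. linear_on fscale sU (carrier (V \<otimes> W)) h \<and>
      (\<forall>v\<in>carrier V. \<forall>w\<in>carrier W. h (tens V W v w) = g v w)" by blast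
  from someI_ex[OF this]
  show "linear_on fscale sU (carrier (V \<otimes> W)) (lift V W sU g)"
    and "\<And>v w. v \<in> carrier V \<Longrightarrow> w \<in> carrier W \<Longrightarrow> lift V W sU g (tens V W v w) = g v w"
    unfolding lift_def by blast+
qed

end

(* Since A and B are connected, the unit conditions fix an extension of t in degree n + 1 on
   A_0 (x) B and A (x) B_0, so only its restriction f to (B_+ (x) A_+)_{n+1} is free. The pentagon
   identity is equivalent to the two hexagon identities t(1 (x) mu) = (mu (x) 1)(1 (x) t)(t (x) 1)
   and its mirror image. In total degree n + 1, with all arguments of positive degree, the hexagon
   for b (x) a (x) a' involves the new values of t only at b (x) aa' and at t^B(b (x) a) (x) a', and
   collecting these gives f delta = R. Two solutions f differ by an arbitrary linear map on
   coker delta, and (A (x) B)_{n+1} contains a copy of (B_+ (x) A_+)_{n+1}, whence uniqueness holds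
   only if delta is onto. *)

theory Submission
  imports Defs
begin

section \<open>Total linear maps on tensor products\<close>

text \<open>The condition on \<open>f\<close> is linear because of a degree count. Write
  \<open>T (b \<otimes> a)\<close> as \<open>1 \<otimes> t^B(b \<otimes> a)\<close> plus a remainder
  in \<open>A_+ \<otimes> B\<close>. In the hexagon at \<open>b \<otimes> a \<otimes> a'\<close> the
  remainder spends positive degree on its factor in \<open>A_+\<close>, so the second application of
  \<open>T\<close> to it happens in degree at most n; only the first summand reaches degree n + 1.
  This is the origin of \<open>t - i_B t^B\<close> in R, and dually of \<open>t - i_A t^A\<close>.
  Hexagons with an argument of degree 0 follow from the unit conditions, those of total degree at
  most n are inherited, so nothing else constrains \<open>f\<close>. The equivalence of pentagon and
  hexagons survives truncation because gradedness of \<open>T\<close> keeps every intermediate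
  argument within the given total degree. The obstacle is one of domains: \<open>t\<close> is
  meaningful on a carrier only, and a tensor product is a proper subspace of its ambient type. Hence
  \<open>t\<close> is replaced by an arbitrary total linear extension \<open>T\<close>, identities
  are checked on pure tensors, and every identity of linear maps needs its argument to be known as a
  homogeneous tensor.\<close>

abbreviation lin :: "('k \<Rightarrow> 'v::ab_group_add \<Rightarrow> 'v) \<Rightarrow> ('k \<Rightarrow> 'w::ab_group_add \<Rightarrow> 'w) \<Rightarrow> ('v \<Rightarrow> 'w) \<Rightarrow> bool"
  where "lin s1 s2 f \<equiv> linear_on s1 s2 UNIV f"

text \<open>The maps \<open>lift\<close>, \<open>assoc_l\<close>, \<open>assoc_r\<close>, \<open>tmap\<close>, \<open>inner_map\<close>, \<open>mu\<close> are specified on carriers only.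
  The maps \<open>blift\<close>, \<open>al\<close>, \<open>ar\<close>, \<open>tm\<close>, \<open>inn\<close>, \<open>muh\<close> are counterparts that are linear on the whole
  ambient type, so that they can be evaluated on pure tensors without side conditions. They depend on
  the scalar multiplications alone, as does \<open>ten\<close>.\<close>

definition bilin where
  "bilin s1 s2 s3 g \<longleftrightarrow> (\<forall>y. lin s1 s3 (\<lambda>x. g x y)) \<and> (\<forall>x. lin s2 s3 (g x))"

definition ten :: "('k::field \<Rightarrow> 'v::ab_group_add \<Rightarrow> 'v) \<Rightarrow> ('k \<Rightarrow> 'w::ab_group_add \<Rightarrow> 'w)
    \<Rightarrow> 'v \<Rightarrow> 'w \<Rightarrow> (('v \<times> 'w) \<Rightarrow>\<^sub>0 'k)"
  where "ten sV sW v w = quotient_map sV sW (gen v w)"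

definition blift :: "('k::field \<Rightarrow> 'u::ab_group_add \<Rightarrow> 'u) \<Rightarrow> ('v \<Rightarrow> 'w \<Rightarrow> 'u) \<Rightarrow> (('v \<times> 'w) \<Rightarrow>\<^sub>0 'k) \<Rightarrow> 'u"
  where "blift sU g x = (\<Sum>z\<in>Poly_Mapping.keys x. sU (Poly_Mapping.lookup x z) (g (fst z) (snd z)))"

lemma linD:
  assumes "lin s1 s2 f"
  shows "f (x + y) = f x + f y" "f (s1 c x) = s2 c (f x)" "f 0 = 0" "f (- x) = - f x"
    "f (x - y) = f x - f y"
proof -
  show add: "f (x + y) = f x + f y" for x y using assms by (simp add: linear_on_def)
  show "f (s1 c x) = s2 c (f x)" using assms by (simp add: linear_on_def)
  show 0: "f 0 = 0" using add[of 0 0] by simp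
  show "f (- x) = - f x" for x using add[of x "- x"] 0 by (simp add: eq_neg_iff_add_eq_0 add.commute)
  then show "f (x - y) = f x - f y" using add[of x "- y"] by simp
qed

lemma linI:
  assumes "\<And>x y. f (x + y) = f x + f y" "\<And>c x. f (s1 c x) = s2 c (f x)"
  shows "lin s1 s2 f"
  using assms by (simp add: linear_on_def)

lemma lin_imp_linear_on: "lin s1 s2 f \<Longrightarrow> linear_on s1 s2 S f"
  by (simp add: linear_on_def)

lemma bilinI:
  assumes "\<And>y. lin s1 s3 (\<lambda>x. g x y)" "\<And>x. lin s2 s3 (\<lambda>y. g x y)"
  shows "bilin s1 s2 s3 g"
  using assms by (simp add: bilin_def)

lemma lin_id: "lin s s (\<lambda>x. x)"
  by (simp add: linear_on_def)

lemma lin_comp: "lin s2 s3 f \<Longrightarrow> lin s1 s2 g \<Longrightarrow> lin s1 s3 (\<lambda>x. f (g x))"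
  by (simp add: linear_on_def)

lemma lin_add:
  assumes "vector_space s2" "lin s1 s2 f" "lin s1 s2 g"
  shows "lin s1 s2 (\<lambda>x. f x + g x)"
proof -
  interpret vector_space s2 by fact
  show ?thesis by (rule linI) (simp_all add: linD[OF assms(2)] linD[OF assms(3)] scale_right_distrib)
qed

lemma lin_diff:
  assumes "vector_space s2" "lin s1 s2 f" "lin s1 s2 g"
  shows "lin s1 s2 (\<lambda>x. f x - g x)"
proof -
  interpret vector_space s2 by fact
  show ?thesis
    by (rule linI) (simp_all add: linD[OF assms(2)] linD[OF assms(3)] scale_right_diff_distrib)
qed

lemma lin_setsum:
  assumes "vector_space s2" "\<And>i. i \<in> I \<Longrightarrow> lin s1 s2 (f i)"
  shows "lin s1 s2 (\<lambda>x. \<Sum>i\<in>I. f i x)"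
proof -
  interpret vector_space s2 by fact
  show ?thesis
    by (rule linI) (simp_all add: linD[OF assms(2)] sum.distrib scale_sum_right cong: sum.cong)
qed

lemma ten_bilinear:
  "ten sV sW (v + v') w = ten sV sW v w + ten sV sW v' w"
  "ten sV sW v (w + w') = ten sV sW v w + ten sV sW v w'"
  "ten sV sW (sV c v) w = fscale c (ten sV sW v w)"
  "ten sV sW v (sW c w) = fscale c (ten sV sW v w)"
  using tens_bilinear[of "\<lparr>scl = sV, deg = undefined\<rparr>" "\<lparr>scl = sW, deg = undefined\<rparr>"]
  by (simp_all add: tens_def ten_def)

lemma lin_ten:
  "lin s sV f \<Longrightarrow> lin s fscale (\<lambda>x. ten sV sW (f x) w)"
  "lin s sW g \<Longrightarrow> lin s fscale (\<lambda>x. ten sV sW v (g x))"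
  by (simp_all add: linear_on_def ten_bilinear)

lemma ten_zero [simp]: "ten sV sW 0 w = 0" "ten sV sW v 0 = 0"
  using ten_bilinear(1)[of sV sW 0 0 w] ten_bilinear(2)[of sV sW v 0 0] by simp_all

text \<open>Supports may shrink under addition and scaling, so linearity of \<open>blift\<close> is
  checked over one finite set containing all supports involved.\<close>

lemma blift_superset:
  assumes "vector_space sU" "finite S" "Poly_Mapping.keys x \<subseteq> S"
  shows "blift sU g x = (\<Sum>z\<in>S. sU (Poly_Mapping.lookup x z) (g (fst z) (snd z)))"
proof -
  interpret vector_space sU by fact
  show ?thesis unfolding blift_def
    by (rule sum.mono_neutral_left) (use assms in \<open>auto simp: in_keys_iff\<close>)
qed

lemma lin_blift:
  fixes sU :: "'k::field \<Rightarrow> 'u::ab_group_add \<Rightarrow> 'u" and g :: "'v \<Rightarrow> 'w \<Rightarrow> 'u"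
  assumes "vector_space sU" shows "lin fscale sU (blift sU g)"
proof -
  interpret vector_space sU by fact
  show ?thesis
  proof (rule linI)
    fix x y :: "('v \<times> 'w) \<Rightarrow>\<^sub>0 'k"
    let ?S = "Poly_Mapping.keys x \<union> Poly_Mapping.keys y"
    have "Poly_Mapping.keys (x + y) \<subseteq> ?S" by (rule Poly_Mapping.keys_add)
    then show "blift sU g (x + y) = blift sU g x + blift sU g y"
      by (simp add: blift_superset[OF assms, where S = ?S] lookup_add scale_left_distrib sum.distrib)
  next
    fix c and x :: "('v \<times> 'w) \<Rightarrow>\<^sub>0 'k"
    have "Poly_Mapping.keys (fscale c x) \<subseteq> Poly_Mapping.keys x" by (auto simp: in_keys_iff)
    then show "blift sU g (fscale c x) = sU c (blift sU g x)"
      by (simp add: blift_superset[OF assms, where S = "Poly_Mapping.keys x"] scale_sum_right)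
  qed
qed

text \<open>Serves curried lifts, such as those in \<open>al\<close> and \<open>ar\<close>, where
  the inner lift carries an outer variable as a parameter.\<close>

lemma lin_blift_param:
  assumes "vector_space sU" "\<And>v w. lin s sU (\<lambda>x. g x v w)"
  shows "lin s sU (\<lambda>x. blift sU (g x) y)"
proof -
  interpret vector_space sU by fact
  show ?thesis
    by (rule linI)
      (simp_all add: blift_def linD[OF assms(2)] scale_right_distrib sum.distrib scale_sum_right
        mult.commute)
qed

text \<open>Bilinearity makes \<open>blift sU g\<close> vanish on the relations, and
  \<open>quotient_map\<close> changes a generator only by a relation.\<close>

lemma blift_ten:
  assumes "vector_space sU" "bilin sV sW sU g"
  shows "blift sU g (ten sV sW v w) = g v w"
proof -
  interpret vector_space sU by fact
  note L = linD[OF lin_blift[OF assms(1), of g]]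
  have g: "lin sV sU (\<lambda>v. g v w)" "lin sW sU (g v)" for v w
    using assms(2) by (auto simp: bilin_def)
  have gen: "blift sU g (gen v w) = g v w" for v w
    by (simp add: blift_def)
  have "free.subspace {x. blift sU g x = 0}"
    by (rule free.subspaceI) (simp_all add: L)
  then have "tensor_relations sV sW \<subseteq> {x. blift sU g x = 0}"
    unfolding tensor_relations_def
    by (intro free.span_minimal) (auto simp: L gen linD[OF g(1)] linD[OF g(2)])
  moreover have "quotient_map sV sW (gen v w) - gen v w \<in> tensor_relations sV sW"
    by (simp add: quotient_map(3)[symmetric] quotient_map_diff quotient_map(2))
  ultimately have "blift sU g (quotient_map sV sW (gen v w) - gen v w) = 0" by blast
  then show ?thesis by (simp add: L gen ten_def)
qed

definition al where
  "al sU sV sW = blift fscale (\<lambda>u. blift fscale (\<lambda>v w. ten fscale sW (ten sU sV u v) w))"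

definition ar where
  "ar sU sV sW = blift fscale (\<lambda>x w. blift fscale (\<lambda>u v. ten sU fscale u (ten sV sW v w)) x)"

definition tm where
  "tm sV sW f g = blift fscale (\<lambda>v w. ten sV sW (f v) (g w))"

lemma lin_al: "lin fscale fscale (al sU sV sW)"
  unfolding al_def by (rule lin_blift[OF vector_space_fscale])

lemma lin_ar: "lin fscale fscale (ar sU sV sW)"
  unfolding ar_def by (rule lin_blift[OF vector_space_fscale])

lemma lin_tm: "lin fscale fscale (tm sV sW f g)"
  unfolding tm_def by (rule lin_blift[OF vector_space_fscale])

lemma bilin_al_aux: "bilin sV sW fscale (\<lambda>v w. ten fscale sW (ten sU sV u v) w)"
  by (intro bilinI lin_ten lin_id)

lemma bilin_al: "bilin sU fscale fscale (\<lambda>u. blift fscale (\<lambda>v w. ten fscale sW (ten sU sV u v) w))"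
  by (intro bilinI lin_blift_param lin_blift vector_space_fscale lin_ten lin_id)

lemma bilin_ar_aux: "bilin sU sV fscale (\<lambda>u v. ten sU fscale u (ten sV sW v w))"
  by (intro bilinI lin_ten lin_id)

lemma bilin_ar:
  "bilin fscale sW fscale (\<lambda>x w. blift fscale (\<lambda>u v. ten sU fscale u (ten sV sW v w)) x)"
  by (intro bilinI lin_blift_param lin_blift vector_space_fscale lin_ten lin_id)

lemma bilin_tm:
  assumes "lin s1 sV f" "lin s2 sW g"
  shows "bilin s1 s2 fscale (\<lambda>v w. ten sV sW (f v) (g w))"
  by (intro bilinI lin_ten assms)

lemma al_ten [simp]:
  "al sU sV sW (ten sU fscale u (ten sV sW v w)) = ten fscale sW (ten sU sV u v) w"
  by (simp add: al_def blift_ten[OF vector_space_fscale bilin_al]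
      blift_ten[OF vector_space_fscale bilin_al_aux])

lemma ar_ten [simp]:
  "ar sU sV sW (ten fscale sW (ten sU sV u v) w) = ten sU fscale u (ten sV sW v w)"
  by (simp add: ar_def blift_ten[OF vector_space_fscale bilin_ar]
      blift_ten[OF vector_space_fscale bilin_ar_aux])

lemma tm_ten:
  assumes "lin s1 sV f" "lin s2 sW g"
  shows "tm sV sW f g (ten s1 s2 v w) = ten sV sW (f v) (g w)"
  by (simp add: tm_def blift_ten[OF vector_space_fscale bilin_tm[OF assms]])


section \<open>Homogeneous components of tensor products\<close>

lemma scl_simps [simp]:
  "scl (V \<otimes> W) = fscale" "scl (trunc n X) = scl X" "scl (pos Y) = scl Y"
  by (simp_all add: gtensor_def trunc_def pos_def)

lemma deg_trunc: "deg (trunc n V) i = (if i \<le> n then deg V i else {0})"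
  by (simp add: trunc_def)

lemma deg_pos: "deg (pos V) i = (if i = 0 then {0} else deg V i)"
  by (simp add: pos_def)

lemma tens_eq_ten: "tens V W = ten (scl V) (scl W)"
  by (simp add: tens_def ten_def fun_eq_iff)

lemma deg_tensor: "deg (V \<otimes> W) m =
  free.span {ten (scl V) (scl W) v w | k l v w. k + l = m \<and> v \<in> deg V k \<and> w \<in> deg W l}"
  by (simp add: gtensor_def tens_eq_ten)

lemma subspace_deg_tensor: "free.subspace (deg (V \<otimes> W) m)"
  unfolding deg_tensor by (rule free.subspace_span)

lemma subspace_carrier: "vector_space (scl V) \<Longrightarrow> module.subspace (scl V) (carrier V)"
  unfolding carrier_def by (simp add: module.subspace_span module_iff_vector_space)

lemma deg_carrier: "vector_space (scl V) \<Longrightarrow> x \<in> deg V i \<Longrightarrow> x \<in> carrier V"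
  unfolding carrier_def using module.span_base[of "scl V"] module_iff_vector_space by blast

lemma carrier_trunc_mono:
  assumes "vector_space (scl V)" "i \<le> n"
  shows "carrier (trunc i V) \<subseteq> carrier (trunc n V)"
proof -
  interpret vector_space "scl V" by fact
  have "x \<in> carrier (trunc n V)" if "x \<in> deg (trunc i V) k" for x k
    using that deg_carrier[of "trunc n V" x k] subspace_0[OF subspace_carrier[of "trunc n V", simplified]]
      assms by (auto simp: deg_trunc split: if_splits)
  then show ?thesis
    using subspace_carrier[of "trunc n V"] assms(1)
    unfolding carrier_def[of "trunc i V"] scl_simps by (intro span_minimal) auto
qed

lemma ten_in_deg:
  assumes "v \<in> deg V k" "w \<in> deg W l" "sV = scl V" "sW = scl W"
  shows "ten sV sW v w \<in> deg (V \<otimes> W) (k + l)"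
  unfolding deg_tensor using assms by (auto intro!: free.span_base)

text \<open>The linear map \<open>L\<close> makes the rule iterable: for a nested tensor it is
  applied again to \<open>L\<close> composed with tensoring by a fixed factor. The premises
  \<open>v \<noteq> 0\<close> and \<open>w \<noteq> 0\<close> are harmless since
  \<open>L 0 = 0\<close>, and they are what turns membership in \<open>deg (pos V) k\<close> or
  \<open>deg (trunc n V) k\<close> into \<open>k > 0\<close> or \<open>k \<le> n\<close>.\<close>

lemma deg_tensor_induct:
  assumes "vector_space s" "lin fscale s L" "module.subspace s S" "x \<in> deg (V \<otimes> W) m"
    and "\<And>k l v w. k + l = m \<Longrightarrow> v \<in> deg V k \<Longrightarrow> w \<in> deg W l \<Longrightarrow> v \<noteq> 0 \<Longrightarrow> w \<noteq> 0 \<Longrightarrow>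
      L (ten (scl V) (scl W) v w) \<in> S"
  shows "L x \<in> S"
proof -
  interpret vector_space s by fact
  have "L (ten (scl V) (scl W) v w) \<in> S" if "k + l = m" "v \<in> deg V k" "w \<in> deg W l" for k l v w
    using assms(5)[OF that] by (cases "v = 0 \<or> w = 0") (auto simp: linD[OF assms(2)] subspace_0[OF assms(3)])
  moreover have "free.subspace {x. L x \<in> S}"
    by (rule free.subspaceI)
      (use assms(3) in \<open>auto simp: linD[OF assms(2)] subspace_0 subspace_add subspace_scale\<close>)
  ultimately have "deg (V \<otimes> W) m \<subseteq> {x. L x \<in> S}"
    unfolding deg_tensor by (intro free.span_minimal) auto
  then show ?thesis using assms(4) by blast
qed

lemma deg_tensor_eqI:
  assumes "vector_space s" "lin fscale s L" "lin fscale s M" "x \<in> deg (V \<otimes> W) m"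
    and "\<And>k l v w. k + l = m \<Longrightarrow> v \<in> deg V k \<Longrightarrow> w \<in> deg W l \<Longrightarrow> v \<noteq> 0 \<Longrightarrow> w \<noteq> 0 \<Longrightarrow>
      L (ten (scl V) (scl W) v w) = M (ten (scl V) (scl W) v w)"
  shows "L x = M x"
proof -
  interpret vector_space s by fact
  have "L x - M x \<in> {0}"
    by (rule deg_tensor_induct[OF assms(1) lin_diff[OF assms(1-3)] _ assms(4)]) (simp_all add: assms(5))
  then show ?thesis by simp
qed

lemma carrier_induct:
  assumes "vector_space (scl V)" "vector_space s" "lin (scl V) s L" "module.subspace s S"
    "x \<in> carrier V" and "\<And>i x. x \<in> deg V i \<Longrightarrow> L x \<in> S"
  shows "L x \<in> S"
proof -
  interpret V: vector_space "scl V" by fact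
  interpret S: vector_space s by fact
  have "V.subspace {x. L x \<in> S}"
    by (rule V.subspaceI)
      (use assms(4) in \<open>auto simp: linD[OF assms(3)] S.subspace_0 S.subspace_add S.subspace_scale\<close>)
  then have "carrier V \<subseteq> {x. L x \<in> S}"
    unfolding carrier_def by (intro V.span_minimal) (use assms(6) in auto)
  then show ?thesis using assms(5) by blast
qed

lemma carrier_eqI:
  assumes "vector_space (scl V)" "lin (scl V) s L" "lin (scl V) s M" "vector_space s" "x \<in> carrier V"
    and "\<And>i x. x \<in> deg V i \<Longrightarrow> L x = M x"
  shows "L x = M x"
proof -
  interpret vector_space s by fact
  have "L x - M x \<in> {0}"
    by (rule carrier_induct[OF assms(1,4) lin_diff[OF assms(4,2,3)] _ assms(5)]) (simp_all add: assms(6))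
  then show ?thesis by simp
qed

lemma tm_deg:
  assumes "x \<in> deg (V \<otimes> W) m" "lin (scl V) sV' f" "lin (scl W) sW' g" "sV' = scl V'" "sW' = scl W'"
    and "\<And>k l v w. k + l = m \<Longrightarrow> v \<in> deg V k \<Longrightarrow> w \<in> deg W l \<Longrightarrow> v \<noteq> 0 \<Longrightarrow> w \<noteq> 0 \<Longrightarrow>
      f v \<in> deg V' k \<and> g w \<in> deg W' l"
  shows "tm sV' sW' f g x \<in> deg (V' \<otimes> W') m"
proof (rule deg_tensor_induct[OF vector_space_fscale lin_tm subspace_deg_tensor assms(1)])
  fix k l v w assume *: "k + l = m" "v \<in> deg V k" "w \<in> deg W l" "v \<noteq> 0" "w \<noteq> 0"
  then have "f v \<in> deg V' k" "g w \<in> deg W' l" using assms(6)[OF *] by auto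
  then show "tm sV' sW' f g (ten (scl V) (scl W) v w) \<in> deg (V' \<otimes> W') m"
    unfolding tm_ten[OF assms(2,3)] *(1)[symmetric] using assms(4,5) by (intro ten_in_deg)
qed

text \<open>Tensors depend on the scalar multiplications alone, so \<open>V\<close>,
  \<open>pos V\<close> and \<open>trunc n V\<close> yield subspaces of one ambient type. This rule
  moves an element between them by comparing the degrees of its factors.\<close>

lemma deg_tensor_mono:
  assumes "x \<in> deg (V \<otimes> W) m" "scl V = scl V'" "scl W = scl W'"
    and "\<And>k l v w. k + l = m \<Longrightarrow> v \<in> deg V k \<Longrightarrow> w \<in> deg W l \<Longrightarrow> v \<noteq> 0 \<Longrightarrow> w \<noteq> 0 \<Longrightarrow>
      v \<in> deg V' k \<and> w \<in> deg W' l"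
  shows "x \<in> deg (V' \<otimes> W') m"
proof (rule deg_tensor_induct[OF vector_space_fscale lin_id subspace_deg_tensor assms(1)])
  fix k l v w assume *: "k + l = m" "v \<in> deg V k" "w \<in> deg W l" "v \<noteq> 0" "w \<noteq> 0"
  then have "v \<in> deg V' k" "w \<in> deg W' l" using assms(4)[OF *] by auto
  then show "ten (scl V) (scl W) v w \<in> deg (V' \<otimes> W') m"
    unfolding *(1)[symmetric] using assms(2,3) by (intro ten_in_deg)
qed

lemma al_deg:
  assumes "x \<in> deg (U \<otimes> V \<otimes> W) m" "sU = scl U" "sV = scl V" "sW = scl W"
  shows "al sU sV sW x \<in> deg ((U \<otimes> V) \<otimes> W) m"
proof (rule deg_tensor_induct[OF vector_space_fscale lin_al subspace_deg_tensor assms(1)])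
  fix k l u y assume k: "k + l = m" and u: "u \<in> deg U k" and y: "y \<in> deg (V \<otimes> W) l"
  show "al sU sV sW (ten (scl U) (scl (V \<otimes> W)) u y) \<in> deg ((U \<otimes> V) \<otimes> W) m"
    unfolding scl_simps
  proof (rule deg_tensor_induct[OF vector_space_fscale lin_comp[OF lin_al lin_ten(2)[OF lin_id]]
        subspace_deg_tensor y])
    fix k' l' v w assume "k' + l' = l" "v \<in> deg V k'" "w \<in> deg W l'"
    then show "al sU sV sW (ten (scl U) fscale u (ten (scl V) (scl W) v w)) \<in> deg ((U \<otimes> V) \<otimes> W) m"
      using ten_in_deg[OF ten_in_deg[OF u \<open>v \<in> deg V k'\<close> refl refl] \<open>w \<in> deg W l'\<close>
          scl_simps(1)[symmetric] refl] k
      by (auto simp: assms(2-) add.assoc)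
  qed
qed

lemma ar_deg:
  assumes "x \<in> deg ((U \<otimes> V) \<otimes> W) m" "sU = scl U" "sV = scl V" "sW = scl W"
  shows "ar sU sV sW x \<in> deg (U \<otimes> V \<otimes> W) m"
proof (rule deg_tensor_induct[OF vector_space_fscale lin_ar subspace_deg_tensor assms(1)])
  fix k l y w assume k: "k + l = m" and y: "y \<in> deg (U \<otimes> V) k" and w: "w \<in> deg W l"
  show "ar sU sV sW (ten (scl (U \<otimes> V)) (scl W) y w) \<in> deg (U \<otimes> V \<otimes> W) m"
    unfolding scl_simps
  proof (rule deg_tensor_induct[OF vector_space_fscale lin_comp[OF lin_ar lin_ten(1)[OF lin_id]]
        subspace_deg_tensor y])
    fix k' l' u v assume "k' + l' = k" "u \<in> deg U k'" "v \<in> deg V l'"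
    then show "ar sU sV sW (ten fscale (scl W) (ten (scl U) (scl V) u v) w) \<in> deg (U \<otimes> V \<otimes> W) m"
      using ten_in_deg[OF \<open>u \<in> deg U k'\<close> ten_in_deg[OF \<open>v \<in> deg V l'\<close> w refl refl] refl
          scl_simps(1)[symmetric]] k
      by (auto simp: assms(2-) add.assoc)
  qed
qed


section \<open>Comparison with the maps defined on carriers\<close>

lemma vector_space_gtensor: "vector_space (scl (V \<otimes> W))"
  by (simp add: vector_space_fscale)

text \<open>The predicate under the choice operator in \<open>lift\<close> sees \<open>g\<close> on
  the carriers only, so both choices are literally the same.\<close>

lemma lift_cong:
  assumes "\<And>v w. v \<in> carrier V \<Longrightarrow> w \<in> carrier W \<Longrightarrow> g v w = g' v w"
  shows "lift V W sU g = lift V W sU g'"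
  unfolding lift_def using assms by (metis (mono_tags, lifting))

text \<open>Both maps solve the same universal problem. Agreement of \<open>g'\<close> with
  \<open>g\<close> is required on carriers only, because \<open>g'\<close> is often built from maps
  that are themselves specified just there.\<close>

lemma lift_eq_blift:
  assumes "vector_space (scl V)" "vector_space (scl W)" "vector_space sU"
    and "bilin (scl V) (scl W) sU g"
    and "\<And>v w. v \<in> carrier V \<Longrightarrow> w \<in> carrier W \<Longrightarrow> g' v w = g v w"
    and "x \<in> carrier (V \<otimes> W)"
  shows "lift V W sU g' x = blift sU g x"
proof -
  have b: "lin (scl V) sU (\<lambda>v. g v w)" "lin (scl W) sU (g v)" for v w
    using assms(4) by (auto simp: bilin_def)
  note l = tensor_lift[OF assms(1-3), of g, OF lin_imp_linear_on[OF b(1)] lin_imp_linear_on[OF b(2)]]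
  have "lift V W sU g x = blift sU g x"
    by (rule tensor_lift_unique[OF assms(1-3) l(1) lin_imp_linear_on[OF lin_blift[OF assms(3)]] _ assms(6)])
      (simp add: l(2)[unfolded tens_eq_ten] tens_eq_ten blift_ten[OF assms(3,4)])
  then show ?thesis using lift_cong[of V W g' g sU] assms(5) by simp
qed

lemma tmap_eq:
  assumes "vector_space (scl V)" "vector_space (scl W)" "x \<in> carrier (V \<otimes> W)"
    and "lin (scl V) sV' f" "lin (scl W) sW' g" "sV' = scl V'" "sW' = scl W'"
    and "\<And>v. v \<in> carrier V \<Longrightarrow> f' v = f v" "\<And>w. w \<in> carrier W \<Longrightarrow> g' w = g w"
  shows "tmap V W V' W' f' g' x = tm sV' sW' f g x"
  unfolding tmap_def tm_def
  by (rule lift_eq_blift[OF assms(1,2) vector_space_fscale bilin_tm[OF assms(4,5)] _ assms(3)])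
    (simp add: tens_eq_ten assms(6-))

lemma assoc_l_eq:
  assumes "vector_space (scl U)" "vector_space (scl V)" "vector_space (scl W)"
    "x \<in> carrier (U \<otimes> V \<otimes> W)" "sU = scl U" "sV = scl V" "sW = scl W"
  shows "assoc_l U V W x = al sU sV sW x"
  unfolding assoc_l_def al_def
proof (rule lift_eq_blift[OF assms(1) vector_space_gtensor vector_space_fscale _ _ assms(4)])
  fix u y assume "y \<in> carrier (V \<otimes> W)"
  then show "lift V W fscale (\<lambda>v w. tens (U \<otimes> V) W (tens U V u v) w) y =
      blift fscale (\<lambda>v w. ten fscale sW (ten sU sV u v) w) y"
    using assms
    by (intro lift_eq_blift[OF assms(2,3) vector_space_fscale])
      (auto simp: tens_eq_ten bilin_al_aux)
qed (simp add: bilin_al assms(5-))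

lemma assoc_r_eq:
  assumes "vector_space (scl U)" "vector_space (scl V)" "vector_space (scl W)"
    "x \<in> carrier ((U \<otimes> V) \<otimes> W)" "sU = scl U" "sV = scl V" "sW = scl W"
  shows "assoc_r U V W x = ar sU sV sW x"
  unfolding assoc_r_def ar_def
proof (rule lift_eq_blift[OF vector_space_gtensor assms(3) vector_space_fscale _ _ assms(4)])
  fix y w assume "y \<in> carrier (U \<otimes> V)"
  then show "lift U V fscale (\<lambda>u v. tens U (V \<otimes> W) u (tens V W v w)) y =
      blift fscale (\<lambda>u v. ten sU fscale u (ten sV sW v w)) y"
    using assms
    by (intro lift_eq_blift[OF assms(1,2) vector_space_fscale])
      (auto simp: tens_eq_ten bilin_ar_aux)
qed (simp add: bilin_ar assms(5-))

definition inn where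
  "inn sU sV sW sV' sW' sX f x = al sU sV' fscale (tm sU fscale (\<lambda>u. u) (ar sV' sW' sX)
     (tm sU fscale (\<lambda>u. u) (tm fscale sX f (\<lambda>u. u))
       (tm sU fscale (\<lambda>u. u) (al sV sW sX) (ar sU sV fscale x))))"

lemma lin_inn: "lin fscale fscale (inn sU sV sW sV' sW' sX f)"
  unfolding inn_def by (intro lin_comp[OF lin_al] lin_comp[OF lin_ar] lin_comp[OF lin_tm] lin_id)

lemma inn_ten:
  assumes "lin fscale fscale f"
  shows "inn sU sV sW sV' sW' sX f (ten fscale fscale (ten sU sV u v) (ten sW sX w x)) =
    al sU sV' fscale (ten sU fscale u (ar sV' sW' sX (ten fscale sX (f (ten sV sW v w)) x)))"
  unfolding inn_def
  by (simp add: tm_ten[OF lin_id lin_al] tm_ten[OF lin_id lin_tm] tm_ten[OF lin_id lin_ar]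
      tm_ten[OF assms lin_id])

text \<open>Each stage of \<open>inner_map\<close> is identified with its total counterpart once the
  stage's argument is located in degree \<open>i\<close>. The degree statement comes out of the same
  chain and lets two such maps be composed in the twisting identity.\<close>

lemma inner_map_eq:
  assumes vs: "vector_space (scl U)" "vector_space (scl V)" "vector_space (scl W)"
      "vector_space (scl V')" "vector_space (scl W')" "vector_space (scl X)"
    and x: "x \<in> deg ((U \<otimes> V) \<otimes> (W \<otimes> X)) i"
    and f: "lin fscale fscale f" "\<And>z. z \<in> carrier (trunc i (V \<otimes> W)) \<Longrightarrow> f' z = f z"
      "\<And>k z. k \<le> i \<Longrightarrow> z \<in> deg (V \<otimes> W) k \<Longrightarrow> f z \<in> deg (V' \<otimes> W') k"
  shows "inner_map U V W (trunc i (V \<otimes> W)) V' W' X f' x =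
      inn (scl U) (scl V) (scl W) (scl V') (scl W') (scl X) f x" (is "?l = ?r")
    and "inn (scl U) (scl V) (scl W) (scl V') (scl W') (scl X) f x \<in> deg ((U \<otimes> V') \<otimes> (W' \<otimes> X)) i"
proof -
  let ?D = "trunc i (V \<otimes> W)"
  define x1 where "x1 = ar (scl U) (scl V) fscale x"
  define x2 where "x2 = tm (scl U) fscale (\<lambda>u. u) (al (scl V) (scl W) (scl X)) x1"
  define x3 where "x3 = tm (scl U) fscale (\<lambda>u. u) (tm fscale (scl X) f (\<lambda>u. u)) x2"
  define x4 where "x4 = tm (scl U) fscale (\<lambda>u. u) (ar (scl V') (scl W') (scl X)) x3"
  have c: "z \<in> deg Z k \<Longrightarrow> scl Z = fscale \<Longrightarrow> z \<in> carrier Z" for z k and Z :: "('a, ('z \<Rightarrow>\<^sub>0 'a)) gspace"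
    by (rule deg_carrier) (simp_all add: vector_space_fscale)
  have vsD: "vector_space (scl ?D)" by (simp add: vector_space_fscale)
  have d1: "x1 \<in> deg (U \<otimes> V \<otimes> W \<otimes> X) i"
    unfolding x1_def by (rule ar_deg[OF x]) simp_all
  have d2: "x2 \<in> deg (U \<otimes> (V \<otimes> W) \<otimes> X) i"
    unfolding x2_def by (rule tm_deg[OF d1]) (simp_all add: lin_id lin_al al_deg)
  \<comment> \<open>In total degree \<open>i\<close> the inner factor has degree at most
    \<open>i\<close>, so it lies in the truncated domain, where \<open>f'\<close> agrees with
    \<open>f\<close>.\<close>
  have d2': "x2 \<in> deg (U \<otimes> ?D \<otimes> X) i"
  proof (rule deg_tensor_mono[OF d2], goal_cases)
    case (3 k l v w)
    then show ?case by (auto intro: deg_tensor_mono simp: deg_trunc)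
  qed simp_all
  have d3: "x3 \<in> deg (U \<otimes> (V' \<otimes> W') \<otimes> X) i"
    unfolding x3_def
  proof (rule tm_deg[OF d2], goal_cases)
    case (5 k l v w)
    then show ?case by (auto intro!: tm_deg[of w "V \<otimes> W"] simp: lin_id f)
  qed (simp_all add: lin_id lin_tm)
  have d4: "x4 \<in> deg (U \<otimes> V' \<otimes> W' \<otimes> X) i"
    unfolding x4_def by (rule tm_deg[OF d3]) (simp_all add: lin_id lin_ar ar_deg)
  have e1: "assoc_r U V (W \<otimes> X) x = x1"
    unfolding x1_def using vs by (intro assoc_r_eq c[OF x]) (simp_all add: vector_space_fscale)
  have e2: "tmap U (V \<otimes> W \<otimes> X) U ((V \<otimes> W) \<otimes> X) (\<lambda>u. u) (assoc_l V W X) x1 = x2"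
    unfolding x2_def using vs
    by (intro tmap_eq c[OF d1] assoc_l_eq) (simp_all add: vector_space_fscale lin_id lin_al)
  have e3: "tmap U (?D \<otimes> X) U ((V' \<otimes> W') \<otimes> X) (\<lambda>u. u)
               (tmap ?D X (V' \<otimes> W') X f' (\<lambda>u. u)) x2 = x3"
    unfolding x3_def using vs
    by (intro tmap_eq c[OF d2']) (simp_all add: vector_space_fscale lin_id lin_tm f)
  have e4: "tmap U ((V' \<otimes> W') \<otimes> X) U (V' \<otimes> W' \<otimes> X) (\<lambda>u. u) (assoc_r V' W' X) x3 = x4"
    unfolding x4_def using vs
    by (intro tmap_eq c[OF d3] assoc_r_eq) (simp_all add: vector_space_fscale lin_id lin_ar)
  have r: "?r = al (scl U) (scl V') fscale x4"
    unfolding inn_def x4_def x3_def x2_def x1_def ..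
  show "?l = ?r"
    unfolding inner_map_def Let_def e1 e2 e3 e4 r
    using vs by (intro assoc_l_eq c[OF d4]) (simp_all add: vector_space_fscale)
  show "?r \<in> deg ((U \<otimes> V') \<otimes> (W' \<otimes> X)) i"
    unfolding r by (rule al_deg[OF d4]) simp_all
qed

lemma projection_exists:
  assumes "vector_space s" "module.subspace s S"
  obtains p where "lin s s p" "range p \<subseteq> S" "\<And>x. x \<in> S \<Longrightarrow> p x = x"
proof -
  interpret vector_space s by fact
  interpret vector_space_pair s s by unfold_locales
  have "\<exists>p. p ` UNIV \<subseteq> S \<and> Vector_Spaces.linear s s p \<and> (\<forall>v\<in>S. p (id v) = v)"
    by (rule linear_exists_left_inverse_on[OF linear_id assms(2)]) auto
  then obtain p where p: "range p \<subseteq> S" "Vector_Spaces.linear s s p" "\<And>v. v \<in> S \<Longrightarrow> p v = v"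
    by auto
  then show ?thesis by (intro that[of p] linI) (simp_all add: linear_add linear_scale)
qed

text \<open>Precomposition with a projection onto \<open>S\<close> does it.\<close>

lemma linear_on_extend:
  assumes "vector_space s1" "module.subspace s1 S" "linear_on s1 s2 S f"
  obtains g where "lin s1 s2 g" "\<And>x. x \<in> S \<Longrightarrow> g x = f x"
proof -
  obtain p where "lin s1 s1 p" "range p \<subseteq> S" "\<And>x. x \<in> S \<Longrightarrow> p x = x"
    using projection_exists[OF assms(1,2)] by blast
  then have "lin s1 s2 (\<lambda>x. f (p x))" "\<And>x. x \<in> S \<Longrightarrow> f (p x) = f x"
    using assms(3) by (auto simp: linear_on_def image_subset_iff)
  then show ?thesis by (rule that)
qed


section \<open>Connected graded algebras\<close>

context connected_graded_algebra
begin

definition component :: "nat \<Rightarrow> 'a \<Rightarrow> 'a" where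
  "component i x = (THE f. finite {i. f i \<noteq> 0} \<and> (\<forall>i. f i \<in> deg A i) \<and> x = (\<Sum>i | f i \<noteq> 0. f i)) i"

text \<open>The augmentation of the connected algebra \<open>A\<close>, with kernel
  \<open>A_+\<close>; it is well defined because \<open>1 \<noteq> 0\<close>.\<close>

definition counit :: "'a \<Rightarrow> 'k" where
  "counit x = (THE c. component 0 x = scl A c 1)"

lemma zero_in_deg [simp]: "0 \<in> deg A i"
  using subspace_0[OF subspace_deg] .

lemma component_spec:
  "finite {i. component i x \<noteq> 0}" "component i x \<in> deg A i" "x = (\<Sum>i | component i x \<noteq> 0. component i x)"
  using theI'[OF direct_sum[of x]] unfolding component_def by blast+

text \<open>After the zero terms of \<open>f\<close> are discarded, this is the uniqueness of the
  homogeneous decomposition; the free choice of \<open>S\<close> allows sums over a union of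
  supports.\<close>

lemma component_eqI:
  assumes "finite S" "\<And>i. i \<notin> S \<Longrightarrow> f i = 0" "\<And>i. f i \<in> deg A i" "x = (\<Sum>i\<in>S. f i)"
  shows "component i x = f i"
proof -
  have S: "{i. f i \<noteq> 0} \<subseteq> S" using assms(2) by auto
  then have "finite {i. f i \<noteq> 0}" using assms(1) finite_subset by blast
  moreover have "x = (\<Sum>i | f i \<noteq> 0. f i)"
    unfolding assms(4) by (rule sum.mono_neutral_right) (use S assms(1) in auto)
  ultimately show ?thesis
    unfolding component_def using assms(3)
    by (subst the1_equality[OF direct_sum, where a = f]) simp_all
qed

lemma component_sum:
  assumes "finite S" "{i. component i x \<noteq> 0} \<subseteq> S"
  shows "x = (\<Sum>i\<in>S. component i x)"
proof -
  have "(\<Sum>i | component i x \<noteq> 0. component i x) = (\<Sum>i\<in>S. component i x)"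
    by (rule sum.mono_neutral_left) (use assms in auto)
  then show ?thesis using component_spec(3) by simp
qed

lemma component_of_deg: "x \<in> deg A j \<Longrightarrow> component i x = (if i = j then x else 0)"
  by (rule component_eqI[where S = "{j}"]) auto

lemma lin_component: "lin (scl A) (scl A) (component i)"
proof (rule linI)
  fix x y
  let ?S = "{i. component i x \<noteq> 0} \<union> {i. component i y \<noteq> 0}"
  show "component i (x + y) = component i x + component i y"
  proof (rule component_eqI[where S = ?S])
    show "x + y = (\<Sum>i\<in>?S. component i x + component i y)"
      using component_sum[of ?S x] component_sum[of ?S y] by (simp add: component_spec sum.distrib)
  qed (auto simp: component_spec intro: subspace_add[OF subspace_deg])
next
  fix c x
  let ?S = "{i. component i x \<noteq> 0}"
  show "component i (scl A c x) = scl A c (component i x)"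
  proof (rule component_eqI[where S = ?S])
    show "scl A c x = (\<Sum>i\<in>?S. scl A c (component i x))"
      using component_sum[of ?S x] by (simp add: component_spec flip: scale_sum_right)
  qed (auto simp: component_spec intro: subspace_scale[OF subspace_deg])
qed

lemma counit_unique: "component 0 x = scl A c 1 \<Longrightarrow> counit x = c"
  unfolding counit_def by (rule the_equality) (auto simp: scale_right_imp_eq)

lemma component_0: "component 0 x = scl A (counit x) 1"
  using component_spec(2)[of 0 x] connected counit_unique by auto

lemma counit_add: "counit (x + y) = counit x + counit y"
  by (rule counit_unique) (simp add: linD[OF lin_component] component_0 scale_left_distrib)

lemma counit_scale: "counit (scl A c x) = c * counit x"
  by (rule counit_unique) (simp add: linD[OF lin_component] component_0)

lemma counit_pos: "x \<in> deg A i \<Longrightarrow> i > 0 \<Longrightarrow> counit x = 0"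
  by (rule counit_unique) (simp add: component_of_deg)

lemma counit_deg_0: "x \<in> deg A 0 \<Longrightarrow> x = scl A (counit x) 1"
  using component_0[of x] by (simp add: component_of_deg)

lemma counit_1 [simp]: "counit 1 = 1"
  by (rule counit_unique) (simp add: component_of_deg[OF one_deg])

text \<open>The decomposition axiom ranges over the whole type, so carrier conditions survive only
  for tensor products.\<close>

lemma carrier_UNIV [simp]: "x \<in> carrier A"
proof -
  have "(\<Sum>i | component i x \<noteq> 0. component i x) \<in> carrier A"
    unfolding carrier_def using component_spec(2) by (blast intro: span_sum span_base)
  then show ?thesis using component_spec(3)[of x] by simp
qed

lemma lin_mult: "lin s (scl A) f \<Longrightarrow> lin s (scl A) (\<lambda>x. f x * c)"
  "lin s (scl A) f \<Longrightarrow> lin s (scl A) (\<lambda>x. c * f x)"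
  by (simp_all add: linear_on_def distrib_left distrib_right scl_mult_left scl_mult_right)

definition muh where "muh = blift (scl A) (*)"

lemma bilin_mult: "bilin (scl A) (scl A) (scl A) (*)"
  by (intro bilinI lin_mult lin_id)

lemma lin_muh: "lin fscale (scl A) muh"
  unfolding muh_def by (rule lin_blift[OF vector_space_axioms])

lemma muh_ten [simp]: "muh (ten (scl A) (scl A) x y) = x * y"
  unfolding muh_def by (rule blift_ten[OF vector_space_axioms bilin_mult])

lemma mu_eq: "x \<in> carrier (A \<otimes> A) \<Longrightarrow> mu A x = muh x"
  unfolding mu_def muh_def
  by (rule lift_eq_blift[OF vector_space_axioms vector_space_axioms vector_space_axioms bilin_mult])
    simp_all

end


section \<open>The hexagon identities\<close>

locale algebra_pair = A: connected_graded_algebra A + B: connected_graded_algebra B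
  for A :: "('k::field, 'a::ring_1) gspace" and B :: "('k, 'b::ring_1) gspace"
begin

abbreviation "sA \<equiv> scl A"
abbreviation "sB \<equiv> scl B"
abbreviation "ab \<equiv> ten sA sB"
abbreviation "ba \<equiv> ten sB sA"

lemmas vs = A.vector_space_axioms B.vector_space_axioms vector_space_fscale

text \<open>\<open>HA T (T (b \<otimes> a)) a'\<close> is \<open>(\<mu>\<^sub>A \<otimes> 1)(1 \<otimes> T)(T \<otimes> 1)\<close> at \<open>b \<otimes> a \<otimes> a'\<close>, and \<open>HB T b' (T (b \<otimes> a))\<close> is
  \<open>(1 \<otimes> \<mu>\<^sub>B)(T \<otimes> 1)(1 \<otimes> T)\<close> at \<open>b' \<otimes> b \<otimes> a\<close>.\<close>

definition lm where "lm p = blift fscale (\<lambda>r s. ab (p * r) s)"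
definition rm where "rm q = blift fscale (\<lambda>r s. ab r (s * q))"
definition HA where "HA T z a = blift fscale (\<lambda>p q. lm p (T (ba q a))) z"
definition HB where "HB T b z = blift fscale (\<lambda>p q. rm q (T (ba b p))) z"

lemma lin_lm: "lin fscale fscale (lm p)"
  unfolding lm_def by (rule lin_blift[OF vector_space_fscale])

lemma lin_rm: "lin fscale fscale (rm q)"
  unfolding rm_def by (rule lin_blift[OF vector_space_fscale])

lemma lin_lm_param: "lin sA fscale (\<lambda>p. lm p z)"
  unfolding lm_def by (intro lin_blift_param vector_space_fscale lin_ten A.lin_mult lin_id)

lemma lin_rm_param: "lin sB fscale (\<lambda>q. rm q z)"
  unfolding rm_def by (intro lin_blift_param vector_space_fscale lin_ten B.lin_mult lin_id)

lemma lm_ten [simp]: "lm p (ab r s) = ab (p * r) s"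
  unfolding lm_def
  by (rule blift_ten[OF vector_space_fscale]) (intro bilinI lin_ten A.lin_mult lin_id)

lemma rm_ten [simp]: "rm q (ab r s) = ab r (s * q)"
  unfolding rm_def
  by (rule blift_ten[OF vector_space_fscale]) (intro bilinI lin_ten B.lin_mult lin_id)

lemma lin_HA: "lin fscale fscale (\<lambda>z. HA T z a)"
  unfolding HA_def by (rule lin_blift[OF vector_space_fscale])

lemma lin_HB: "lin fscale fscale (HB T b)"
  unfolding HB_def by (rule lin_blift[OF vector_space_fscale])

lemma HA_ten:
  assumes "lin fscale fscale T" shows "HA T (ab p q) a = lm p (T (ba q a))"
  unfolding HA_def
  by (rule blift_ten[OF vector_space_fscale])
    (intro bilinI lin_lm_param lin_comp[OF lin_lm] lin_comp[OF assms] lin_ten lin_id)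

lemma HB_ten:
  assumes "lin fscale fscale T" shows "HB T b (ab p q) = rm q (T (ba b p))"
  unfolding HB_def
  by (rule blift_ten[OF vector_space_fscale])
    (intro bilinI lin_rm_param lin_comp[OF lin_rm] lin_comp[OF assms] lin_ten lin_id)

section \<open>The twisting conditions for total linear maps, degree by degree\<close>

definition graded_upto where
  "graded_upto n T \<longleftrightarrow> (\<forall>i\<le>n. \<forall>z\<in>deg (B \<otimes> A) i. T z \<in> deg (A \<otimes> B) i)"

definition unital_upto where
  "unital_upto n T \<longleftrightarrow> (\<forall>i\<le>n. (\<forall>a\<in>deg A i. T (ba 1 a) = ab a 1) \<and> (\<forall>b\<in>deg B i. T (ba b 1) = ab 1 b))"

lemma unital_uptoD:
  assumes "unital_upto n T" "i \<le> n"
  shows "a \<in> deg A i \<Longrightarrow> T (ba 1 a) = ab a 1" "b \<in> deg B i \<Longrightarrow> T (ba b 1) = ab 1 b"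
  using assms by (auto simp: unital_upto_def)

text \<open>The degrees are parameters so that scalar arguments, total degree at most n and total
  degree n + 1 can be treated separately.\<close>

definition hexA where
  "hexA j k l T \<longleftrightarrow> (\<forall>b\<in>deg B j. \<forall>a\<in>deg A k. \<forall>a'\<in>deg A l. T (ba b (a * a')) = HA T (T (ba b a)) a')"

definition hexB where
  "hexB j k l T \<longleftrightarrow> (\<forall>b\<in>deg B j. \<forall>b'\<in>deg B k. \<forall>a\<in>deg A l. T (ba (b * b') a) = HB T b (T (ba b' a)))"

definition hexagons_upto where
  "hexagons_upto n T \<longleftrightarrow> (\<forall>j k l. j + k + l \<le> n \<longrightarrow> hexA j k l T \<and> hexB j k l T)"

text \<open>\<open>pent_inner T b' (T (b \<otimes> a)) a'\<close> is the right-hand side of the twisting identity at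
  \<open>b' \<otimes> b \<otimes> a \<otimes> a'\<close>; \<open>Psi T\<close> is the multiplication of the twisted tensor product.\<close>

definition pent_rhs where
  "pent_rhs T x = tm sA sB A.muh B.muh (inn sA sB sA sA sB sB T
     (tm fscale fscale T T (inn sB sB sA sA sB sA T x)))"

definition Psi where
  "Psi T x y = tm sA sB A.muh B.muh (inn sA sB sA sA sB sB T (ten fscale fscale x y))"

definition pent_inner where
  "pent_inner T b z a = tm sA sB A.muh B.muh (inn sA sB sA sA sB sB T
     (tm fscale fscale T T (al sB sA fscale (ten sB fscale b (ar sA sB sA (ten fscale sA z a))))))"

lemma ba_deg: "b \<in> deg B j \<Longrightarrow> a \<in> deg A k \<Longrightarrow> ba b a \<in> deg (B \<otimes> A) (j + k)"
  by (rule ten_in_deg) simp_all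

lemma ab_deg: "a \<in> deg A j \<Longrightarrow> b \<in> deg B k \<Longrightarrow> ab a b \<in> deg (A \<otimes> B) (j + k)"
  by (rule ten_in_deg) simp_all

lemma AB_eqI:
  assumes "z \<in> deg (A \<otimes> B) m" "lin fscale fscale L" "lin fscale fscale M"
    "\<And>k l p q. k + l = m \<Longrightarrow> p \<in> deg A k \<Longrightarrow> q \<in> deg B l \<Longrightarrow> L (ab p q) = M (ab p q)"
  shows "L z = M z"
  by (rule deg_tensor_eqI[OF vector_space_fscale assms(2,3,1)]) (use assms(4) in auto)

section \<open>Equivalence of the pentagon with the two hexagons up to a given degree\<close>

context
  fixes T :: "(('b \<times> 'a) \<Rightarrow>\<^sub>0 'k) \<Rightarrow> (('a \<times> 'b) \<Rightarrow>\<^sub>0 'k)"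
  assumes T: "lin fscale fscale T"
begin

lemmas lin_T_intros = lin_comp[OF T] lin_comp[OF lin_tm] lin_comp[OF lin_inn] lin_comp[OF lin_al]
  lin_comp[OF lin_ar] lin_comp[OF lin_lm] lin_comp[OF lin_rm] lin_ten lin_lm_param lin_rm_param
  lin_id lin_lm lin_rm

lemma lin_pent_rhs: "lin fscale fscale (pent_rhs T)"
  unfolding pent_rhs_def by (intro lin_T_intros)

lemma pent_rhs_ten:
  "pent_rhs T (ten fscale fscale (ten sB sB b' b) (ten sA sA a a')) = pent_inner T b' (T (ba b a)) a'"
  by (simp add: pent_rhs_def pent_inner_def inn_ten[OF T])

lemma lin_pent_inner: "lin fscale fscale (\<lambda>z. pent_inner T b z a)"
  unfolding pent_inner_def by (intro lin_T_intros)

lemma lin_Psi: "lin fscale fscale (Psi T x)" "lin fscale fscale (\<lambda>x. Psi T x y)"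
  unfolding Psi_def by (intro lin_T_intros)+

lemma pent_inner_ten: "pent_inner T b (ab p q) a = Psi T (T (ba b p)) (T (ba q a))"
  by (simp add: pent_inner_def Psi_def tm_ten[OF T T])

text \<open>The product \<open>(p \<otimes> q)(r \<otimes> s) = p T(q \<otimes> r) s\<close> of a
  twisted tensor product. With \<open>T (ba q r)\<close> replaced by a variable \<open>z\<close>,
  both sides are linear in \<open>z\<close> and can be compared on pure tensors; homogeneity puts
  the actual value in their span.\<close>

lemma Psi_ten:
  assumes "T (ba q r) \<in> deg (A \<otimes> B) m"
  shows "Psi T (ab p q) (ab r s) = lm p (rm s (T (ba q r)))"
proof -
  have "tm sA sB A.muh B.muh (al sA sA fscale (ten sA fscale p (ar sA sB sB (ten fscale sB z s)))) =
      lm p (rm s z)" if "z \<in> deg (A \<otimes> B) m" for z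
    by (rule AB_eqI[OF that])
      (simp_all add: lin_T_intros tm_ten[OF A.lin_muh B.lin_muh])
  then show ?thesis
    unfolding Psi_def inn_ten[OF T] using assms by blast
qed

text \<open>Inserting \<open>b' = 1\<close> in the pentagon gives \<open>hexA\<close>, inserting
  \<open>a' = 1\<close> gives \<open>hexB\<close>. A unit has degree 0, so the total degree is
  unchanged.\<close>

lemma pentagon_imp_hexagons:
  assumes gr: "graded_upto n T" and un: "unital_upto n T"
    and pent: "\<And>i j k l b' b a a'. i + j + k + l \<le> n \<Longrightarrow> b' \<in> deg B i \<Longrightarrow> b \<in> deg B j \<Longrightarrow>
      a \<in> deg A k \<Longrightarrow> a' \<in> deg A l \<Longrightarrow> T (ba (b' * b) (a * a')) = pent_inner T b' (T (ba b a)) a'"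
  shows "hexagons_upto n T"
  unfolding hexagons_upto_def
proof (intro allI impI conjI)
  fix j k l assume n: "j + k + l \<le> n"
  show "hexA j k l T"
    unfolding hexA_def
  proof (intro ballI)
    fix b a a' assume b: "b \<in> deg B j" and a: "a \<in> deg A k" and a': "a' \<in> deg A l"
    have z: "T (ba b a) \<in> deg (A \<otimes> B) (j + k)"
      using gr ba_deg[OF b a] n by (auto simp: graded_upto_def)
    have "pent_inner T 1 (T (ba b a)) a' = HA T (T (ba b a)) a'"
    proof (rule AB_eqI[OF z lin_pent_inner lin_HA])
      fix k' l' p q assume kl: "k' + l' = j + k" and p: "p \<in> deg A k'" and q: "q \<in> deg B l'"
      have y: "T (ba q a') \<in> deg (A \<otimes> B) (l' + l)"
        using gr ba_deg[OF q a'] n kl by (auto simp: graded_upto_def)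
      \<comment> \<open>In the twisted product \<open>p \<otimes> 1\<close> acts as left
        multiplication by \<open>p\<close>, because
        \<open>T (1 \<otimes> r) = r \<otimes> 1\<close>. In the mirror case
        \<open>1 \<otimes> q\<close> acts as right multiplication by \<open>q\<close>.\<close>
      have "Psi T (ab p 1) (T (ba q a')) = lm p (T (ba q a'))"
      proof (rule AB_eqI[OF y lin_Psi(1) lin_lm])
        fix k'' l'' r s assume kl': "k'' + l'' = l' + l" and r: "r \<in> deg A k''" and s: "s \<in> deg B l''"
        have T1: "T (ba 1 r) = ab r 1" by (rule unital_uptoD(1)[OF un _ r]) (use n kl kl' in simp)
        show "Psi T (ab p 1) (ab r s) = lm p (ab r s)"
          using ab_deg[OF r B.one_deg] by (subst Psi_ten[where m = "k''"]) (simp_all add: T1)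
      qed
      moreover have "T (ba 1 p) = ab p 1" by (rule unital_uptoD(1)[OF un _ p]) (use n kl in simp)
      ultimately show "pent_inner T 1 (ab p q) a' = HA T (ab p q) a'"
        by (simp add: pent_inner_ten HA_ten[OF T])
    qed
    then show "T (ba b (a * a')) = HA T (T (ba b a)) a'"
      using pent[OF _ B.one_deg b a a'] n by simp
  qed
  show "hexB j k l T"
    unfolding hexB_def
  proof (intro ballI)
    fix b b' a assume b: "b \<in> deg B j" and b': "b' \<in> deg B k" and a: "a \<in> deg A l"
    have z: "T (ba b' a) \<in> deg (A \<otimes> B) (k + l)"
      using gr ba_deg[OF b' a] n by (auto simp: graded_upto_def)
    have "pent_inner T b (T (ba b' a)) 1 = HB T b (T (ba b' a))"
    proof (rule AB_eqI[OF z lin_pent_inner lin_HB])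
      fix k' l' p q assume kl: "k' + l' = k + l" and p: "p \<in> deg A k'" and q: "q \<in> deg B l'"
      have y: "T (ba b p) \<in> deg (A \<otimes> B) (j + k')"
        using gr ba_deg[OF b p] n kl by (auto simp: graded_upto_def)
      have "Psi T (T (ba b p)) (ab 1 q) = rm q (T (ba b p))"
      proof (rule AB_eqI[OF y lin_Psi(2) lin_rm])
        fix k'' l'' r s assume kl': "k'' + l'' = j + k'" and r: "r \<in> deg A k''" and s: "s \<in> deg B l''"
        have T1: "T (ba s 1) = ab 1 s" by (rule unital_uptoD(2)[OF un _ s]) (use n kl kl' in simp)
        show "Psi T (ab r s) (ab 1 q) = rm q (ab r s)"
          by (subst Psi_ten[where m = "0 + l''"]) (simp_all only: T1 ab_deg[OF A.one_deg s], simp)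
      qed
      moreover have "T (ba q 1) = ab 1 q" by (rule unital_uptoD(2)[OF un _ q]) (use n kl in simp)
      ultimately show "pent_inner T b (ab p q) 1 = HB T b (ab p q)"
        by (simp add: pent_inner_ten HB_ten[OF T])
    qed
    then show "T (ba (b * b') a) = HB T b (T (ba b' a))"
      using pent[OF _ b b' a A.one_deg] n by simp
  qed
qed

text \<open>On \<open>w = c \<otimes> d\<close> both sides are \<open>c T(d \<otimes> r) s\<close>,
  since left multiplication on \<open>A\<close> commutes with right multiplication on
  \<open>B\<close>. It recognises a product \<open>Psi\<close> in the hexagon expression.\<close>

lemma HA_rm:
  assumes "w \<in> deg (A \<otimes> B) m"
    and "\<And>k d. k \<le> m \<Longrightarrow> d \<in> deg B k \<Longrightarrow> T (ba d r) \<in> deg (A \<otimes> B) (k + l)"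
  shows "rm s (HA T w r) = Psi T w (ab r s)"
proof (rule AB_eqI[OF assms(1) _ lin_Psi(2)])
  show "lin fscale fscale (\<lambda>w. rm s (HA T w r))" by (rule lin_comp[OF lin_rm lin_HA])
  fix i j c d assume ij: "i + j = m" and c: "c \<in> deg A i" and d: "d \<in> deg B j"
  have y: "T (ba d r) \<in> deg (A \<otimes> B) (j + l)" using assms(2) d ij by auto
  have "rm s (lm c (T (ba d r))) = lm c (rm s (T (ba d r)))"
    by (rule AB_eqI[OF y]) (simp_all add: lin_T_intros)
  then show "rm s (HA T (ab c d) r) = Psi T (ab c d) (ab r s)"
    by (simp add: HA_ten[OF T] Psi_ten[OF y])
qed

text \<open>\<open>hexB\<close> splits \<open>b' * b\<close> and \<open>hexA\<close> splits
  \<open>a * a'\<close>. With \<open>p \<otimes> q\<close> in \<open>T (b \<otimes> a)\<close> and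
  \<open>r \<otimes> s\<close> in \<open>T (q \<otimes> a')\<close>, there remains
  \<open>T (b' \<otimes> pr) s\<close>, to which \<open>hexA\<close> applies once more; the outcome
  is the product of \<open>T (b' \<otimes> p)\<close> and \<open>T (q \<otimes> a')\<close>.\<close>

lemma hexagons_imp_pentagon:
  assumes gr: "graded_upto n T" and hex: "hexagons_upto n T"
    and n: "i + j + k + l \<le> n" and b': "b' \<in> deg B i" and b: "b \<in> deg B j"
    and a: "a \<in> deg A k" and a': "a' \<in> deg A l"
  shows "T (ba (b' * b) (a * a')) = pent_inner T b' (T (ba b a)) a'"
proof -
  have gr': "T (ba v u) \<in> deg (A \<otimes> B) (s + r)" if "v \<in> deg B s" "u \<in> deg A r" "s + r \<le> n" for u v r s
    using gr ba_deg[OF that(1,2)] that(3) by (auto simp: graded_upto_def)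
  have "HB T b' (HA T (T (ba b a)) a') = pent_inner T b' (T (ba b a)) a'"
  proof (rule AB_eqI[OF gr'[OF b a] _ lin_pent_inner])
    show "j + k \<le> n" using n by simp
    show "lin fscale fscale (\<lambda>z. HB T b' (HA T z a'))" by (rule lin_comp[OF lin_HB lin_HA])
    fix k' l' p q assume kl: "k' + l' = j + k" and p: "p \<in> deg A k'" and q: "q \<in> deg B l'"
    have y: "T (ba q a') \<in> deg (A \<otimes> B) (l' + l)" using n kl by (intro gr'[OF q a']) simp
    have "HB T b' (lm p (T (ba q a'))) = Psi T (T (ba b' p)) (T (ba q a'))"
    proof (rule AB_eqI[OF y lin_comp[OF lin_HB lin_lm] lin_Psi(1)])
      fix k'' l'' r s assume kl': "k'' + l'' = l' + l" and r: "r \<in> deg A k''" and s: "s \<in> deg B l''"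
      \<comment> \<open>Admissible because \<open>k'' \<le> l' + l\<close> and
        \<open>k' + l' = j + k\<close> bound the total degree by
        \<open>i + j + k + l\<close>.\<close>
      have "hexA i k' k'' T" using hex n kl kl' by (auto simp: hexagons_upto_def)
      then have "T (ba b' (p * r)) = HA T (T (ba b' p)) r"
        using b' p r by (auto simp: hexA_def)
      moreover have "rm s (HA T (T (ba b' p)) r) = Psi T (T (ba b' p)) (ab r s)"
      proof (rule HA_rm[OF gr'[OF b' p]])
        show "i + k' \<le> n" using n kl by simp
        fix k d assume "k \<le> i + k'" "d \<in> deg B k"
        then show "T (ba d r) \<in> deg (A \<otimes> B) (k + k'')" using n kl kl' by (intro gr'[OF _ r]) auto
      qed
      ultimately show "HB T b' (lm p (ab r s)) = Psi T (T (ba b' p)) (ab r s)"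
        by (simp add: HB_ten[OF T])
    qed
    then show "HB T b' (HA T (ab p q) a') = pent_inner T b' (ab p q) a'"
      by (simp add: HA_ten[OF T] pent_inner_ten)
  qed
  moreover have "T (ba (b' * b) (a * a')) = HB T b' (T (ba b (a * a')))"
  proof -
    have "hexB i j (k + l) T" using hex n by (simp add: hexagons_upto_def)
    then show ?thesis using b' b A.mult_deg[OF a a'] by (auto simp: hexB_def)
  qed
  moreover have "T (ba b (a * a')) = HA T (T (ba b a)) a'"
  proof -
    have "hexA j k l T" using hex n by (auto simp: hexagons_upto_def)
    then show ?thesis using a a' b by (auto simp: hexA_def)
  qed
  ultimately show ?thesis by simp
qed

text \<open>An argument of degree \<open>i\<close> stays in degree \<open>i\<close> through all
  stages, so \<open>t\<close> is evaluated only where it agrees with \<open>T\<close>.\<close>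

lemma pentagon_eq:
  assumes gr: "graded_upto n T" and i: "i \<le> n"
    and t: "\<And>x. x \<in> carrier (trunc n (B \<otimes> A)) \<Longrightarrow> t x = T x"
    and x: "x \<in> deg ((B \<otimes> B) \<otimes> (A \<otimes> A)) i"
  shows "t (tmap (B \<otimes> B) (A \<otimes> A) B A (mu B) (mu A) x) = T (tm sB sA B.muh A.muh x)"
    and "tmap (A \<otimes> A) (B \<otimes> B) A B (mu A) (mu B)
           (inner_map A B A (trunc i (B \<otimes> A)) A B B t
             (tmap (trunc i (B \<otimes> A)) (trunc i (B \<otimes> A)) (A \<otimes> B) (A \<otimes> B) t t
               (inner_map B B A (trunc i (B \<otimes> A)) A B A t x))) = pent_rhs T x"
proof -
  let ?D = "trunc i (B \<otimes> A)"
  have c: "z \<in> deg Z k \<Longrightarrow> scl Z = fscale \<Longrightarrow> z \<in> carrier Z" for z k and Z :: "('k, ('z \<Rightarrow>\<^sub>0 'k)) gspace"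
    by (rule deg_carrier) (simp_all add: vector_space_fscale)
  have muhA: "A.muh z \<in> deg A k" if "z \<in> deg (A \<otimes> A) k" for z k
    by (rule deg_tensor_induct[OF A.vector_space_axioms A.lin_muh A.subspace_deg that])
      (auto intro: A.mult_deg)
  have muhB: "B.muh z \<in> deg B k" if "z \<in> deg (B \<otimes> B) k" for z k
    by (rule deg_tensor_induct[OF B.vector_space_axioms B.lin_muh B.subspace_deg that])
      (auto intro: B.mult_deg)
  have m: "tm sB sA B.muh A.muh x \<in> deg (B \<otimes> A) i"
    by (rule tm_deg[OF x]) (simp_all add: B.lin_muh A.lin_muh muhA muhB)
  have "tm sB sA B.muh A.muh x \<in> carrier (trunc n (B \<otimes> A))"
    by (rule c[of _ _ i]) (use m i in \<open>simp_all add: deg_trunc\<close>)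
  moreover have "tmap (B \<otimes> B) (A \<otimes> A) B A (mu B) (mu A) x = tm sB sA B.muh A.muh x"
    by (intro tmap_eq c[OF x])
      (simp_all add: vs B.lin_muh A.lin_muh A.mu_eq B.mu_eq)
  ultimately show "t (tmap (B \<otimes> B) (A \<otimes> A) B A (mu B) (mu A) x) = T (tm sB sA B.muh A.muh x)"
    by (simp add: t)
  have "carrier ?D \<subseteq> carrier (trunc n (B \<otimes> A))"
    using i by (intro carrier_trunc_mono vector_space_gtensor)
  then have tD: "t z = T z" if "z \<in> carrier ?D" for z using t that by blast
  have grD: "T z \<in> deg (A \<otimes> B) k" if "k \<le> i" "z \<in> deg (B \<otimes> A) k" for z k
    using gr i that by (auto simp: graded_upto_def)
  define x1 where "x1 = inn sB sB sA sA sB sA T x"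
  define x2 where "x2 = tm fscale fscale T T x1"
  define x3 where "x3 = inn sA sB sA sA sB sB T x2"
  have e1: "inner_map B B A ?D A B A t x = x1" and d1: "x1 \<in> deg ((B \<otimes> A) \<otimes> (B \<otimes> A)) i"
    unfolding x1_def using inner_map_eq[OF vs(2,2,1,1,2,1) x T tD grD] by auto
  have d1': "x1 \<in> deg (?D \<otimes> ?D) i"
    by (rule deg_tensor_mono[OF d1]) (auto simp: deg_trunc)
  have e2: "tmap ?D ?D (A \<otimes> B) (A \<otimes> B) t t x1 = x2"
    unfolding x2_def by (intro tmap_eq c[OF d1']) (simp_all add: vs T tD)
  have d2: "x2 \<in> deg ((A \<otimes> B) \<otimes> (A \<otimes> B)) i"
    unfolding x2_def by (rule tm_deg[OF d1]) (auto simp: T intro!: grD)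
  have e3: "inner_map A B A ?D A B B t x2 = x3" and d3: "x3 \<in> deg ((A \<otimes> A) \<otimes> (B \<otimes> B)) i"
    unfolding x3_def using inner_map_eq[OF vs(1,2,1,1,2,2) d2 T tD grD] by auto
  have e4: "tmap (A \<otimes> A) (B \<otimes> B) A B (mu A) (mu B) x3 = tm sA sB A.muh B.muh x3"
    by (intro tmap_eq c[OF d3]) (simp_all add: vs B.lin_muh A.lin_muh A.mu_eq B.mu_eq)
  show "tmap (A \<otimes> A) (B \<otimes> B) A B (mu A) (mu B)
           (inner_map A B A ?D A B B t (tmap ?D ?D (A \<otimes> B) (A \<otimes> B) t t (inner_map B B A ?D A B A t x)))
         = pent_rhs T x"
    unfolding e1 e2 e3 e4 unfolding pent_rhs_def x1_def x2_def x3_def ..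
qed

text \<open>The bridge from the specification to hexagons. The twisting identity is linear in
  \<open>x\<close>, so it suffices to test pure tensors
  \<open>b' \<otimes> b \<otimes> a \<otimes> a'\<close>, reached by splitting the outer tensor
  product and then its two factors.\<close>

lemma graded_twisting_iff:
  assumes t: "\<And>x. x \<in> carrier (trunc n (B \<otimes> A)) \<Longrightarrow> t x = T x"
  shows "graded_twisting A B n t \<longleftrightarrow> graded_upto n T \<and> unital_upto n T \<and> hexagons_upto n T"
proof -
  have c: "z \<in> carrier (trunc n (B \<otimes> A))" if "z \<in> deg (B \<otimes> A) i" "i \<le> n" for z i
    by (rule deg_carrier[of _ _ i]) (use that in \<open>simp_all add: vector_space_fscale deg_trunc\<close>)
  have sub: "free.subspace (carrier (trunc n (B \<otimes> A)))"
    using subspace_carrier[of "trunc n (B \<otimes> A)"] by (simp add: vector_space_fscale)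
  have "linear_on fscale fscale (carrier (trunc n (B \<otimes> A))) t"
    unfolding linear_on_def
    by (simp add: t free.subspace_add[OF sub] free.subspace_scale[OF sub] linD[OF T])
  then have 1: "graded_linear (trunc n (B \<otimes> A)) (trunc n (A \<otimes> B)) t \<longleftrightarrow> graded_upto n T"
    unfolding graded_linear_def graded_upto_def
    using c t free.subspace_0[OF sub]
    by (auto simp: image_subset_iff deg_trunc linD[OF T] split: if_splits)
  have 2: "(\<forall>a\<in>deg A i. t (tens B A 1 a) = tens A B a 1) \<and> (\<forall>b\<in>deg B i. t (tens B A b 1) = tens A B 1 b) \<longleftrightarrow>
      (\<forall>a\<in>deg A i. T (ba 1 a) = ab a 1) \<and> (\<forall>b\<in>deg B i. T (ba b 1) = ab 1 b)" if "i \<le> n" for i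
    using c[OF ba_deg[OF B.one_deg]] c[OF ba_deg[OF _ A.one_deg]] that t
    by (simp add: tens_eq_ten)
  let ?P = "\<lambda>i. \<forall>x\<in>deg ((B \<otimes> B) \<otimes> (A \<otimes> A)) i. T (tm sB sA B.muh A.muh x) = pent_rhs T x"
  have 3: "(\<forall>i\<le>n. ?P i) \<longleftrightarrow> hexagons_upto n T" if gr: "graded_upto n T" and un: "unital_upto n T"
  proof
    assume P: "\<forall>i\<le>n. ?P i"
    show "hexagons_upto n T"
    proof (rule pentagon_imp_hexagons[OF gr un])
      fix i j k l b' b a a'
      assume *: "i + j + k + l \<le> n" "b' \<in> deg B i" "b \<in> deg B j" "a \<in> deg A k" "a' \<in> deg A l"
      let ?x = "ten fscale fscale (ten sB sB b' b) (ten sA sA a a')"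
      have "?x \<in> deg ((B \<otimes> B) \<otimes> (A \<otimes> A)) ((i + j) + (k + l))"
        using * by (intro ten_in_deg) simp_all
      moreover have "(i + j) + (k + l) \<le> n" using *(1) by simp
      ultimately have "T (tm sB sA B.muh A.muh ?x) = pent_rhs T ?x"
        using P by blast
      then show "T (ba (b' * b) (a * a')) = pent_inner T b' (T (ba b a)) a'"
        by (simp add: pent_rhs_ten tm_ten[OF B.lin_muh A.lin_muh])
    qed
  next
    assume hex: "hexagons_upto n T"
    show "\<forall>i\<le>n. ?P i"
    proof (intro allI impI ballI)
      fix i x assume i: "i \<le> n" and x: "x \<in> deg ((B \<otimes> B) \<otimes> (A \<otimes> A)) i"
      let ?L = "\<lambda>x. T (tm sB sA B.muh A.muh x)"
      have L: "lin fscale fscale ?L" by (intro lin_comp[OF T] lin_tm)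
      show "?L x = pent_rhs T x"
      proof (rule deg_tensor_eqI[OF vector_space_fscale L lin_pent_rhs x], unfold scl_simps)
        fix k l v w assume kl: "k + l = i" and v: "v \<in> deg (B \<otimes> B) k" and w: "w \<in> deg (A \<otimes> A) l"
        show "?L (ten fscale fscale v w) = pent_rhs T (ten fscale fscale v w)"
        proof (rule deg_tensor_eqI[OF vector_space_fscale lin_comp[OF L lin_ten(1)[OF lin_id]]
              lin_comp[OF lin_pent_rhs lin_ten(1)[OF lin_id]] v])
          fix k1 k2 b' b assume kk: "k1 + k2 = k" and b: "b' \<in> deg B k1" "b \<in> deg B k2"
          show "?L (ten fscale fscale (ten sB sB b' b) w) = pent_rhs T (ten fscale fscale (ten sB sB b' b) w)"
          proof (rule deg_tensor_eqI[OF vector_space_fscale lin_comp[OF L lin_ten(2)[OF lin_id]]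
                lin_comp[OF lin_pent_rhs lin_ten(2)[OF lin_id]] w])
            fix l1 l2 a a' assume ll: "l1 + l2 = l" and a: "a \<in> deg A l1" "a' \<in> deg A l2"
            show "?L (ten fscale fscale (ten sB sB b' b) (ten sA sA a a')) =
                pent_rhs T (ten fscale fscale (ten sB sB b' b) (ten sA sA a a'))"
              using hexagons_imp_pentagon[OF gr hex _ b a] i kl kk ll
              by (simp add: pent_rhs_ten tm_ten[OF B.lin_muh A.lin_muh])
          qed
        qed
      qed
    qed
  qed
  have "graded_twisting A B n t \<longleftrightarrow> graded_upto n T \<and> unital_upto n T \<and> (\<forall>i\<le>n. ?P i)"
    unfolding graded_twisting_def Let_def 1 unital_upto_def
    using 2 pentagon_eq[OF _ _ t] by (auto 0 3)
  then show ?thesis using 3 by blast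
qed

end


section \<open>The maps delta and R\<close>

text \<open>The projection onto \<open>A\<close> as the identity of \<open>A\<close> tensored with
  the augmentation of \<open>B\<close>.\<close>

definition pA where "pA = blift sA (\<lambda>p q. sA (B.counit q) p)"
definition pB where "pB = blift sB (\<lambda>p q. sB (A.counit p) q)"

lemma lin_pA: "lin fscale sA pA"
  unfolding pA_def by (rule lin_blift[OF vs(1)])

lemma lin_pB: "lin fscale sB pB"
  unfolding pB_def by (rule lin_blift[OF vs(2)])

lemma pA_ten [simp]: "pA (ab p q) = sA (B.counit q) p"
  unfolding pA_def
  by (rule blift_ten[OF vs(1)], intro bilinI linI)
    (simp_all add: A.scale_right_distrib A.scale_left_distrib A.scale_left_commute B.counit_add B.counit_scale)

lemma pB_ten [simp]: "pB (ab p q) = sB (A.counit p) q"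
  unfolding pB_def
  by (rule blift_ten[OF vs(2)], intro bilinI linI)
    (simp_all add: B.scale_right_distrib B.scale_left_distrib B.scale_left_commute A.counit_add A.counit_scale)

lemma pA_deg: "z \<in> deg (A \<otimes> B) m \<Longrightarrow> pA z \<in> deg A m"
proof (rule deg_tensor_induct[OF vs(1) lin_pA A.subspace_deg])
  fix k l p q assume "k + l = m" "p \<in> deg A k" "q \<in> deg B l"
  then show "pA (ab p q) \<in> deg A m"
    by (cases "l = 0") (auto simp: B.counit_pos A.subspace_scale[OF A.subspace_deg])
qed

lemma pB_deg: "z \<in> deg (A \<otimes> B) m \<Longrightarrow> pB z \<in> deg B m"
proof (rule deg_tensor_induct[OF vs(2) lin_pB B.subspace_deg])
  fix k l p q assume "k + l = m" "p \<in> deg A k" "q \<in> deg B l"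
  then show "pB (ab p q) \<in> deg B m"
    by (cases "k = 0") (auto simp: A.counit_pos B.subspace_scale[OF B.subspace_deg])
qed

lemma lin_minus_pA: "lin fscale fscale (\<lambda>z. z - ab (pA z) 1)"
  by (intro lin_diff lin_ten lin_pA lin_id vector_space_fscale)

lemma lin_minus_pB: "lin fscale fscale (\<lambda>z. z - ab 1 (pB z))"
  by (intro lin_diff lin_ten lin_pB lin_id vector_space_fscale)

text \<open>If \<open>q\<close> has degree 0 it is a multiple of 1 and the difference vanishes; if
  it has positive degree, \<open>pA\<close> kills \<open>p \<otimes> q\<close>. The positive factor
  obtained here is what later lowers the degree at which \<open>T\<close> is evaluated.\<close>

lemma minus_pA_deg: "z \<in> deg (A \<otimes> B) m \<Longrightarrow> z - ab (pA z) 1 \<in> deg (A \<otimes> pos B) m"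
proof (rule deg_tensor_induct[OF vector_space_fscale lin_minus_pA subspace_deg_tensor])
  fix k l p q assume *: "k + l = m" "p \<in> deg A k" "q \<in> deg B l"
  show "ab p q - ab (pA (ab p q)) 1 \<in> deg (A \<otimes> pos B) m"
  proof (cases "l = 0")
    case True
    then have "ab p q = fscale (B.counit q) (ab p 1)"
      using B.counit_deg_0[of q] *(3) ten_bilinear(4)[of sA sB p "B.counit q" 1] by simp
    then show ?thesis
      by (simp add: linD(2)[OF lin_pA] ten_bilinear free.subspace_0[OF subspace_deg_tensor])
  next
    case False
    then show ?thesis
      using ten_in_deg[of p A k q "pos B" l] * by (simp add: B.counit_pos deg_pos)
  qed
qed

lemma minus_pB_deg: "z \<in> deg (A \<otimes> B) m \<Longrightarrow> z - ab 1 (pB z) \<in> deg (pos A \<otimes> B) m"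
proof (rule deg_tensor_induct[OF vector_space_fscale lin_minus_pB subspace_deg_tensor])
  fix k l p q assume *: "k + l = m" "p \<in> deg A k" "q \<in> deg B l"
  show "ab p q - ab 1 (pB (ab p q)) \<in> deg (pos A \<otimes> B) m"
  proof (cases "k = 0")
    case True
    then have "ab p q = fscale (A.counit p) (ab 1 q)"
      using A.counit_deg_0[of p] *(2) ten_bilinear(3)[of sA sB "A.counit p" 1 q] by simp
    then show ?thesis
      by (simp add: linD(2)[OF lin_pB] ten_bilinear free.subspace_0[OF subspace_deg_tensor])
  next
    case False
    then show ?thesis
      using ten_in_deg[of p "pos A" k q B l] * by (simp add: A.counit_pos deg_pos)
  qed
qed

text \<open>Existence is \<open>minus_pA_deg\<close>, extended from homogeneous elements to the
  carrier. Uniqueness holds because \<open>pA\<close> kills \<open>A \<otimes> pos B\<close> and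
  maps \<open>a \<otimes> 1\<close> to \<open>a\<close>.\<close>

lemma proj_A_eq:
  assumes "z \<in> carrier (A \<otimes> B)" shows "proj_A A B z = pA z"
  unfolding proj_A_def
proof (rule the_equality)
  have "z - ab (pA z) 1 \<in> carrier (A \<otimes> pos B)"
    by (rule carrier_induct[where V = "A \<otimes> B"])
      (use assms minus_pA_deg deg_carrier[of "A \<otimes> pos B"] subspace_carrier[of "A \<otimes> pos B"]
        in \<open>auto simp: vector_space_fscale lin_minus_pA\<close>)
  then show "z - tens A B (pA z) 1 \<in> carrier (A \<otimes> pos B)" by (simp add: tens_eq_ten)
next
  fix a assume a: "z - tens A B a 1 \<in> carrier (A \<otimes> pos B)"
  have "pA w = 0" if "w \<in> carrier (A \<otimes> pos B)" for w
  proof (rule carrier_eqI[OF vector_space_gtensor _ _ vs(1) that])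
    show "lin (scl (A \<otimes> pos B)) sA pA" by (simp add: lin_pA)
    show "lin (scl (A \<otimes> pos B)) sA (\<lambda>_. 0)" by (simp add: linI)
    fix i w assume "w \<in> deg (A \<otimes> pos B) i"
    then show "pA w = 0"
      by (rule deg_tensor_eqI[OF vs(1) lin_pA, rotated])
        (auto simp: linI deg_pos B.counit_pos split: if_splits)
  qed
  from this[OF a] show "a = pA z" by (simp add: linD[OF lin_pA] tens_eq_ten)
qed

lemma proj_B_eq:
  assumes "z \<in> carrier (A \<otimes> B)" shows "proj_B A B z = pB z"
  unfolding proj_B_def
proof (rule the_equality)
  have "z - ab 1 (pB z) \<in> carrier (pos A \<otimes> B)"
    by (rule carrier_induct[where V = "A \<otimes> B"])
      (use assms minus_pB_deg deg_carrier[of "pos A \<otimes> B"] subspace_carrier[of "pos A \<otimes> B"]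
        in \<open>auto simp: vector_space_fscale lin_minus_pB\<close>)
  then show "z - tens A B 1 (pB z) \<in> carrier (pos A \<otimes> B)" by (simp add: tens_eq_ten)
next
  fix b assume b: "z - tens A B 1 b \<in> carrier (pos A \<otimes> B)"
  have "pB w = 0" if "w \<in> carrier (pos A \<otimes> B)" for w
  proof (rule carrier_eqI[OF vector_space_gtensor _ _ vs(2) that])
    show "lin (scl (pos A \<otimes> B)) sB pB" by (simp add: lin_pB)
    show "lin (scl (pos A \<otimes> B)) sB (\<lambda>_. 0)" by (simp add: linI)
    fix i w assume "w \<in> deg (pos A \<otimes> B) i"
    then show "pB w = 0"
      by (rule deg_tensor_eqI[OF vs(2) lin_pB, rotated])
        (auto simp: linI deg_pos A.counit_pos split: if_splits)
  qed
  from this[OF b] show "b = pB z" by (simp add: linD[OF lin_pB] tens_eq_ten)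
qed

text \<open>\<open>delta1\<close>, \<open>delta2\<close>, \<open>R1\<close>, \<open>R2\<close> are
  the total counterparts of \<delta> and R on each summand. In degree n + 1 of the summands they see
  only the values of \<open>T\<close> in degrees at most n.\<close>

definition delta1 where
  "delta1 T x = tm sB sA (\<lambda>b. b) A.muh x - tm sB sA (\<lambda>z. pB (T z)) (\<lambda>a. a) (al sB sA sA x)"

definition delta2 where
  "delta2 T y = tm sB sA B.muh (\<lambda>a. a) (al sB sB sA y) - tm sB sA (\<lambda>b. b) (\<lambda>z. pA (T z)) y"

definition R1 where
  "R1 T x = tm sA sB A.muh (\<lambda>b. b) (al sA sA sB (tm sA fscale (\<lambda>a. a) T
     (ar sA sB sA (tm fscale sA (\<lambda>z. T z - ab 1 (pB (T z))) (\<lambda>a. a) (al sB sA sA x)))))"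

definition R2 where
  "R2 T y = tm sA sB (\<lambda>a. a) B.muh (ar sA sB sB (tm fscale sB T (\<lambda>b. b)
     (al sB sA sB (tm sB fscale (\<lambda>b. b) (\<lambda>z. T z - ab (pA (T z)) 1) y))))"

lemma lin_delta1: "lin fscale fscale (delta1 T)"
  unfolding delta1_def by (intro lin_diff lin_comp[OF lin_tm] lin_tm lin_al vector_space_fscale)

lemma lin_delta2: "lin fscale fscale (delta2 T)"
  unfolding delta2_def by (intro lin_diff lin_comp[OF lin_tm] lin_tm lin_al vector_space_fscale)

lemma lin_R1: "lin fscale fscale (R1 T)"
  unfolding R1_def
  by (intro lin_comp[OF lin_tm] lin_comp[OF lin_al] lin_comp[OF lin_ar] lin_al)

lemma lin_R2: "lin fscale fscale (R2 T)"
  unfolding R2_def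
  by (intro lin_comp[OF lin_tm] lin_comp[OF lin_al] lin_comp[OF lin_ar] lin_tm)

context
  fixes T :: "(('b \<times> 'a) \<Rightarrow>\<^sub>0 'k) \<Rightarrow> (('a \<times> 'b) \<Rightarrow>\<^sub>0 'k)" and n :: nat
  assumes T: "lin fscale fscale T" and gr: "graded_upto n T"
begin

lemma T_deg: "z \<in> deg (B \<otimes> A) i \<Longrightarrow> i \<le> n \<Longrightarrow> T z \<in> deg (A \<otimes> B) i"
  using gr by (simp add: graded_upto_def)

lemma lin_pBT: "lin fscale sB (\<lambda>z. pB (T z))"
  by (rule lin_comp[OF lin_pB T])

lemma lin_pAT: "lin fscale sA (\<lambda>z. pA (T z))"
  by (rule lin_comp[OF lin_pA T])

lemma lin_u: "lin fscale fscale (\<lambda>z. T z - ab 1 (pB (T z)))"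
  by (rule lin_comp[OF lin_minus_pB T])

lemma lin_v: "lin fscale fscale (\<lambda>z. T z - ab (pA (T z)) 1)"
  by (rule lin_comp[OF lin_minus_pA T])

lemma delta1_ten:
  "delta1 T (ten sB fscale b (ten sA sA a a')) = ba b (a * a') - ba (pB (T (ba b a))) a'"
  by (simp add: delta1_def tm_ten[OF lin_id A.lin_muh] tm_ten[OF lin_pBT lin_id])

lemma delta2_ten:
  "delta2 T (ten sB fscale b' (ten sB sA b a)) = ba (b' * b) a - ba b' (pA (T (ba b a)))"
  by (simp add: delta2_def tm_ten[OF B.lin_muh lin_id] tm_ten[OF lin_id lin_pAT])

text \<open>On \<open>w\<close> in \<open>A_+ \<otimes> B\<close> the remaining maps of
  \<open>R1\<close> amount to the hexagon expression \<open>HA T w a'\<close>, by linearity in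
  \<open>w\<close> and then in \<open>T (q \<otimes> a')\<close>.\<close>

lemma R1_ten:
  assumes "j + k \<le> n" "j + k + l \<le> Suc n" "b \<in> deg B j" "a \<in> deg A k" "a' \<in> deg A l"
  shows "R1 T (ten sB fscale b (ten sA sA a a')) = HA T (T (ba b a) - ab 1 (pB (T (ba b a)))) a'"
proof -
  have w: "T (ba b a) - ab 1 (pB (T (ba b a))) \<in> deg (pos A \<otimes> B) (j + k)"
    by (rule minus_pB_deg[OF T_deg[OF ba_deg[OF assms(3,4)] assms(1)]])
  let ?S = "\<lambda>w. tm sA sB A.muh (\<lambda>b. b) (al sA sA sB (tm sA fscale (\<lambda>a. a) T (ar sA sB sA (ten fscale sA w a'))))"
  have "?S w = HA T w a'" if "w \<in> deg (pos A \<otimes> B) (j + k)" for w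
  proof (rule deg_tensor_eqI[OF vector_space_fscale _ lin_HA that], unfold scl_simps)
    show "lin fscale fscale ?S"
      by (intro lin_comp[OF lin_tm] lin_comp[OF lin_al] lin_comp[OF lin_ar] lin_ten lin_id)
    fix k' l' p q assume *: "k' + l' = j + k" "p \<in> deg (pos A) k'" "q \<in> deg B l'" "p \<noteq> 0"
    \<comment> \<open>The factor \<open>p\<close> takes at least one of the n + 1 degrees, so
      \<open>q \<otimes> a'\<close> has degree at most n, where \<open>T\<close> is known to be
      graded.\<close>
    then have "k' > 0" by (cases k') (auto simp: deg_pos)
    then have y: "T (ba q a') \<in> deg (A \<otimes> B) (l' + l)"
      using * assms by (intro T_deg ba_deg) auto
    have "tm sA sB A.muh (\<lambda>b. b) (al sA sA sB (ten sA fscale p (T (ba q a')))) = lm p (T (ba q a'))"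
      by (rule AB_eqI[OF y _ lin_lm])
        (auto simp: tm_ten[OF A.lin_muh lin_id] intro!: lin_comp[OF lin_tm] lin_comp[OF lin_al] lin_ten lin_id)
    then show "?S (ab p q) = HA T (ab p q) a'"
      by (simp add: tm_ten[OF lin_id T] HA_ten[OF T])
  qed
  from this[OF w] show ?thesis by (simp add: R1_def tm_ten[OF lin_u lin_id])
qed

lemma R2_ten:
  assumes "k + l \<le> n" "j + k + l \<le> Suc n" "b' \<in> deg B j" "b \<in> deg B k" "a \<in> deg A l"
  shows "R2 T (ten sB fscale b' (ten sB sA b a)) = HB T b' (T (ba b a) - ab (pA (T (ba b a))) 1)"
proof -
  have w: "T (ba b a) - ab (pA (T (ba b a))) 1 \<in> deg (A \<otimes> pos B) (k + l)"
    by (rule minus_pA_deg[OF T_deg[OF ba_deg[OF assms(4,5)] assms(1)]])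
  let ?S = "\<lambda>w. tm sA sB (\<lambda>a. a) B.muh (ar sA sB sB (tm fscale sB T (\<lambda>b. b) (al sB sA sB (ten sB fscale b' w))))"
  have "?S w = HB T b' w" if "w \<in> deg (A \<otimes> pos B) (k + l)" for w
  proof (rule deg_tensor_eqI[OF vector_space_fscale _ lin_HB that], unfold scl_simps)
    show "lin fscale fscale ?S"
      by (intro lin_comp[OF lin_tm] lin_comp[OF lin_al] lin_comp[OF lin_ar] lin_ten lin_id)
    fix k' l' p q assume *: "k' + l' = k + l" "p \<in> deg A k'" "q \<in> deg (pos B) l'" "q \<noteq> 0"
    then have "l' > 0" by (cases l') (auto simp: deg_pos)
    then have y: "T (ba b' p) \<in> deg (A \<otimes> B) (j + k')"
      using * assms by (intro T_deg ba_deg) auto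
    have "tm sA sB (\<lambda>a. a) B.muh (ar sA sB sB (ten fscale sB (T (ba b' p)) q)) = rm q (T (ba b' p))"
      by (rule AB_eqI[OF y _ lin_rm])
        (auto simp: tm_ten[OF lin_id B.lin_muh] intro!: lin_comp[OF lin_tm] lin_comp[OF lin_ar] lin_ten lin_id)
    then show "?S (ab p q) = HB T b' (ab p q)"
      by (simp add: tm_ten[OF T lin_id] HB_ten[OF T])
  qed
  from this[OF w] show ?thesis by (simp add: R2_def tm_ten[OF lin_id lin_v])
qed

text \<open>The last factor has positive degree, so \<open>T\<close> meets
  \<open>b \<otimes> a\<close> in degree at most n and \<open>pB\<close> returns an element of the
  same positive degree.\<close>

lemma delta1_deg:
  assumes "x \<in> deg (pos B \<otimes> pos A \<otimes> pos A) (Suc n)"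
  shows "delta1 T x \<in> deg (pos B \<otimes> pos A) (Suc n)"
proof (rule deg_tensor_induct[OF vector_space_fscale lin_delta1 subspace_deg_tensor assms], unfold scl_simps)
  fix k l b y assume kl: "k + l = Suc n" and b: "b \<in> deg (pos B) k" "b \<noteq> 0"
    and y: "y \<in> deg (pos A \<otimes> pos A) l"
  show "delta1 T (ten sB fscale b y) \<in> deg (pos B \<otimes> pos A) (Suc n)"
  proof (rule deg_tensor_induct[OF vector_space_fscale lin_comp[OF lin_delta1 lin_ten(2)[OF lin_id]]
        subspace_deg_tensor y], unfold scl_simps)
    fix i j a a' assume ij: "i + j = l"
      and a: "a \<in> deg (pos A) i" "a' \<in> deg (pos A) j" "a \<noteq> 0" "a' \<noteq> 0"
    have pos: "i > 0" "j > 0" "k > 0" and d: "b \<in> deg B k" "a \<in> deg A i" "a' \<in> deg A j"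
      using a b by (auto simp: deg_pos split: if_splits)
    have "pB (T (ba b a)) \<in> deg B (k + i)"
      by (intro pB_deg T_deg ba_deg d) (use pos kl ij in simp)
    moreover have "a * a' \<in> deg A (i + j)" by (intro A.mult_deg d)
    ultimately have "ba (pB (T (ba b a))) a' \<in> deg (pos B \<otimes> pos A) ((k + i) + j)"
      "ba b (a * a') \<in> deg (pos B \<otimes> pos A) (k + (i + j))"
      using pos d by (intro ten_in_deg; simp add: deg_pos)+
    then show "delta1 T (ten sB fscale b (ten sA sA a a')) \<in> deg (pos B \<otimes> pos A) (Suc n)"
      unfolding delta1_ten using kl ij
      by (auto intro: free.subspace_diff[OF subspace_deg_tensor] simp: add.assoc)
  qed
qed

lemma delta2_deg:
  assumes "x \<in> deg (pos B \<otimes> pos B \<otimes> pos A) (Suc n)"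
  shows "delta2 T x \<in> deg (pos B \<otimes> pos A) (Suc n)"
proof (rule deg_tensor_induct[OF vector_space_fscale lin_delta2 subspace_deg_tensor assms], unfold scl_simps)
  fix k l b' y assume kl: "k + l = Suc n" and b': "b' \<in> deg (pos B) k" "b' \<noteq> 0"
    and y: "y \<in> deg (pos B \<otimes> pos A) l"
  show "delta2 T (ten sB fscale b' y) \<in> deg (pos B \<otimes> pos A) (Suc n)"
  proof (rule deg_tensor_induct[OF vector_space_fscale lin_comp[OF lin_delta2 lin_ten(2)[OF lin_id]]
        subspace_deg_tensor y], unfold scl_simps)
    fix i j b a assume ij: "i + j = l"
      and ba: "b \<in> deg (pos B) i" "a \<in> deg (pos A) j" "b \<noteq> 0" "a \<noteq> 0"
    have pos: "i > 0" "j > 0" "k > 0" and d: "b' \<in> deg B k" "b \<in> deg B i" "a \<in> deg A j"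
      using ba b' by (auto simp: deg_pos split: if_splits)
    have "pA (T (ba b a)) \<in> deg A (i + j)"
      by (intro pA_deg T_deg ba_deg d) (use pos kl ij in simp)
    moreover have "b' * b \<in> deg B (k + i)" by (intro B.mult_deg d)
    ultimately have "ba b' (pA (T (ba b a))) \<in> deg (pos B \<otimes> pos A) (k + (i + j))"
      "ba (b' * b) a \<in> deg (pos B \<otimes> pos A) ((k + i) + j)"
      using pos d by (intro ten_in_deg; simp add: deg_pos)+
    then show "delta2 T (ten sB fscale b' (ten sB sA b a)) \<in> deg (pos B \<otimes> pos A) (Suc n)"
      unfolding delta2_ten using kl ij
      by (auto intro: free.subspace_diff[OF subspace_deg_tensor] simp: add.assoc)
  qed
qed

text \<open>Every application of \<open>t\<close> in \<delta> and R leaves out a tensor factor of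
  positive degree. It therefore takes place in degree at most n, where \<open>t\<close> agrees with
  \<open>T\<close>.\<close>

lemma delta_Rmap_eq:
  assumes t: "\<And>x. x \<in> carrier (trunc n (B \<otimes> A)) \<Longrightarrow> t x = T x"
    and x: "x \<in> deg (pos B \<otimes> pos A \<otimes> pos A) (Suc n)"
    and y: "y \<in> deg (pos B \<otimes> pos B \<otimes> pos A) (Suc n)"
  shows "delta A B n t (x, y) = delta1 T x + delta2 T y"
    and "Rmap A B n t (x, y) = R1 T x + R2 T y"
proof -
  let ?D = "trunc n (B \<otimes> A)" and ?m = "Suc n"
  have c: "z \<in> deg Z k \<Longrightarrow> scl Z = fscale \<Longrightarrow> z \<in> carrier Z" for z k and Z :: "('k, ('z \<Rightarrow>\<^sub>0 'k)) gspace"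
    by (rule deg_carrier) (simp_all add: vector_space_fscale)
  have TD: "T z \<in> carrier (A \<otimes> B)" if "z \<in> carrier ?D" for z
  proof (rule carrier_induct[OF _ vector_space_fscale _ _ that])
    show "free.subspace (carrier (A \<otimes> B))"
      using subspace_carrier[of "A \<otimes> B"] by (simp add: vector_space_fscale)
    fix i x assume "x \<in> deg ?D i"
    then show "T x \<in> carrier (A \<otimes> B)"
      using T_deg[of x i] \<open>free.subspace (carrier (A \<otimes> B))\<close>
      by (auto simp: deg_trunc linD[OF T] free.subspace_0 intro: c split: if_splits)
  qed (simp_all add: T vector_space_fscale)
  have tA: "proj_A A B (t z) = pA (T z)" and tB: "proj_B A B (t z) = pB (T z)" if "z \<in> carrier ?D" for z
    using that by (simp_all add: t TD proj_A_eq proj_B_eq)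
  have posBA: "z \<in> deg (B \<otimes> A) k" if "z \<in> deg (pos B \<otimes> pos A) k" for z k
    by (rule deg_tensor_mono[OF that]) (auto simp: deg_pos split: if_splits)
  have x0: "x \<in> deg (B \<otimes> A \<otimes> A) ?m"
    by (rule deg_tensor_mono[OF x]; (rule conjI)?)
      (auto simp: deg_pos split: if_splits elim!: deg_tensor_mono)
  have x1p: "al sB sA sA x \<in> deg ((pos B \<otimes> pos A) \<otimes> pos A) ?m"
    by (rule al_deg[OF x]) simp_all
  have x1D: "al sB sA sA x \<in> deg (?D \<otimes> A) ?m"
    by (rule deg_tensor_mono[OF x1p]) (auto simp: deg_pos deg_trunc intro: posBA split: if_splits)
  have y0: "y \<in> deg (B \<otimes> B \<otimes> A) ?m"
    by (rule deg_tensor_mono[OF y]) (auto simp: deg_pos intro: posBA split: if_splits)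
  have yD: "y \<in> deg (B \<otimes> ?D) ?m"
    by (rule deg_tensor_mono[OF y]) (auto simp: deg_pos deg_trunc intro: posBA split: if_splits)
  have y1: "al sB sB sA y \<in> deg ((B \<otimes> B) \<otimes> A) ?m"
    by (rule al_deg[OF y0]) simp_all
  have ax: "assoc_l B A A x = al sB sA sA x"
    by (intro assoc_l_eq c[OF x0]) (simp_all add: vs)
  have ay: "assoc_l B B A y = al sB sB sA y"
    by (intro assoc_l_eq c[OF y0]) (simp_all add: vs)
  have d1: "tmap B (A \<otimes> A) B A (\<lambda>b. b) (mu A) x = tm sB sA (\<lambda>b. b) A.muh x"
    by (intro tmap_eq c[OF x0]) (simp_all add: vs lin_id A.lin_muh A.mu_eq)
  have d2: "tmap ?D A B A (\<lambda>z. proj_B A B (t z)) (\<lambda>a. a) (al sB sA sA x) =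
      tm sB sA (\<lambda>z. pB (T z)) (\<lambda>a. a) (al sB sA sA x)"
    by (intro tmap_eq c[OF x1D]) (simp_all add: vs lin_id lin_pBT tB)
  have d3: "tmap (B \<otimes> B) A B A (mu B) (\<lambda>a. a) (al sB sB sA y) = tm sB sA B.muh (\<lambda>a. a) (al sB sB sA y)"
    by (intro tmap_eq c[OF y1]) (simp_all add: vs lin_id B.lin_muh B.mu_eq)
  have d4: "tmap B ?D B A (\<lambda>b. b) (\<lambda>z. proj_A A B (t z)) y = tm sB sA (\<lambda>b. b) (\<lambda>z. pA (T z)) y"
    by (intro tmap_eq c[OF yD]) (simp_all add: vs lin_id lin_pAT tA)
  show "delta A B n t (x, y) = delta1 T x + delta2 T y"
    by (simp add: delta_def Let_def ax ay d1 d2 d3 d4 delta1_def delta2_def)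

  define x2 where "x2 = tm fscale sA (\<lambda>z. T z - ab 1 (pB (T z))) (\<lambda>a. a) (al sB sA sA x)"
  define x3 where "x3 = ar sA sB sA x2"
  define x4 where "x4 = tm sA fscale (\<lambda>a. a) T x3"
  define x5 where "x5 = al sA sA sB x4"
  have x2d: "x2 \<in> deg ((pos A \<otimes> B) \<otimes> pos A) ?m"
    unfolding x2_def
    by (rule tm_deg[OF x1p]) (auto simp: lin_u lin_id deg_pos intro!: minus_pB_deg T_deg posBA split: if_splits)
  have x2c: "x2 \<in> deg ((A \<otimes> B) \<otimes> A) ?m"
    by (rule deg_tensor_mono[OF x2d]) (auto simp: deg_pos split: if_splits elim!: deg_tensor_mono)
  have x3d: "x3 \<in> deg (pos A \<otimes> B \<otimes> pos A) ?m"
    unfolding x3_def by (rule ar_deg[OF x2d]) simp_all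
  \<comment> \<open>Subtracting the \<open>pB\<close> part has left a first factor in
    \<open>pos A\<close>; this is what puts the other two factors in the domain of
    \<open>t\<close>.\<close>
  have x3D: "x3 \<in> deg (A \<otimes> ?D) ?m"
    by (rule deg_tensor_mono[OF x3d]) (auto simp: deg_pos deg_trunc split: if_splits elim!: deg_tensor_mono)
  have x4d: "x4 \<in> deg (A \<otimes> A \<otimes> B) ?m"
    unfolding x4_def
    by (rule tm_deg[OF x3d])
      (auto simp: lin_id T deg_pos intro!: T_deg split: if_splits elim!: deg_tensor_mono)
  have x5d: "x5 \<in> deg ((A \<otimes> A) \<otimes> B) ?m"
    unfolding x5_def by (rule al_deg[OF x4d]) simp_all
  have e2: "tmap ?D A (A \<otimes> B) A (\<lambda>z. t z - tens A B 1 (proj_B A B (t z))) (\<lambda>a. a) (al sB sA sA x) = x2"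
    unfolding x2_def by (intro tmap_eq c[OF x1D]) (simp_all add: vs lin_id lin_u t TD proj_B_eq tens_eq_ten)
  have e3: "assoc_r A B A x2 = x3"
    unfolding x3_def by (intro assoc_r_eq c[OF x2c]) (simp_all add: vs)
  have e4: "tmap A ?D A (A \<otimes> B) (\<lambda>a. a) t x3 = x4"
    unfolding x4_def by (intro tmap_eq c[OF x3D]) (simp_all add: vs lin_id T t)
  have e5: "assoc_l A A B x4 = x5"
    unfolding x5_def by (intro assoc_l_eq c[OF x4d]) (simp_all add: vs)
  have e6: "tmap (A \<otimes> A) B A B (mu A) (\<lambda>b. b) x5 = tm sA sB A.muh (\<lambda>b. b) x5"
    by (intro tmap_eq c[OF x5d]) (simp_all add: vs lin_id A.lin_muh A.mu_eq)

  define y2 where "y2 = tm sB fscale (\<lambda>b. b) (\<lambda>z. T z - ab (pA (T z)) 1) y"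
  define y3 where "y3 = al sB sA sB y2"
  define y4 where "y4 = tm fscale sB T (\<lambda>b. b) y3"
  define y5 where "y5 = ar sA sB sB y4"
  have y2d: "y2 \<in> deg (pos B \<otimes> A \<otimes> pos B) ?m"
    unfolding y2_def
    by (rule tm_deg[OF y]) (auto simp: lin_v lin_id deg_pos intro!: minus_pA_deg T_deg posBA split: if_splits)
  have y2c: "y2 \<in> deg (B \<otimes> A \<otimes> B) ?m"
    by (rule deg_tensor_mono[OF y2d]) (auto simp: deg_pos split: if_splits elim!: deg_tensor_mono)
  have y3d: "y3 \<in> deg ((pos B \<otimes> A) \<otimes> pos B) ?m"
    unfolding y3_def by (rule al_deg[OF y2d]) simp_all
  have y3D: "y3 \<in> deg (?D \<otimes> B) ?m"
    by (rule deg_tensor_mono[OF y3d]) (auto simp: deg_pos deg_trunc split: if_splits elim!: deg_tensor_mono)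
  have y4d: "y4 \<in> deg ((A \<otimes> B) \<otimes> B) ?m"
    unfolding y4_def
    by (rule tm_deg[OF y3d])
      (auto simp: lin_id T deg_pos intro!: T_deg split: if_splits elim!: deg_tensor_mono)
  have y5d: "y5 \<in> deg (A \<otimes> B \<otimes> B) ?m"
    unfolding y5_def by (rule ar_deg[OF y4d]) simp_all
  have f2: "tmap B ?D B (A \<otimes> B) (\<lambda>b. b) (\<lambda>z. t z - tens A B (proj_A A B (t z)) 1) y = y2"
    unfolding y2_def by (intro tmap_eq c[OF yD]) (simp_all add: vs lin_id lin_v t TD proj_A_eq tens_eq_ten)
  have f3: "assoc_l B A B y2 = y3"
    unfolding y3_def by (intro assoc_l_eq c[OF y2c]) (simp_all add: vs)
  have f4: "tmap ?D B (A \<otimes> B) B t (\<lambda>b. b) y3 = y4"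
    unfolding y4_def by (intro tmap_eq c[OF y3D]) (simp_all add: vs lin_id T t)
  have f5: "assoc_r A B B y4 = y5"
    unfolding y5_def by (intro assoc_r_eq c[OF y4d]) (simp_all add: vs)
  have f6: "tmap A (B \<otimes> B) A B (\<lambda>a. a) (mu B) y5 = tm sA sB (\<lambda>a. a) B.muh y5"
    by (intro tmap_eq c[OF y5d]) (simp_all add: vs lin_id B.lin_muh B.mu_eq)
  have "R1 T x = tm sA sB A.muh (\<lambda>b. b) x5" "R2 T y = tm sA sB (\<lambda>a. a) B.muh y5"
    unfolding R1_def R2_def x5_def x4_def x3_def x2_def y5_def y4_def y3_def y2_def by rule+
  then show "Rmap A B n t (x, y) = R1 T x + R2 T y"
    by (simp add: Rmap_def Let_def ax e2 e3 e4 e5 e6 f2 f3 f4 f5 f6)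
qed

end


section \<open>Extension by one degree\<close>

lemma lm_1: "z \<in> deg (A \<otimes> B) m \<Longrightarrow> lm 1 z = z"
  by (rule AB_eqI[OF _ lin_lm lin_id]) simp_all

lemma rm_1: "z \<in> deg (A \<otimes> B) m \<Longrightarrow> rm 1 z = z"
  by (rule AB_eqI[OF _ lin_rm lin_id]) simp_all

text \<open>\<open>HA T z a\<close> uses \<open>T\<close> only at \<open>q \<otimes> a\<close> with
  \<open>q\<close> a second factor of \<open>z\<close>. The spaces \<open>V\<close> and
  \<open>W\<close> allow \<open>z\<close> to be restricted to \<open>A_+ \<otimes> B\<close>, which
  bounds the degree of \<open>q\<close>.\<close>

lemma HA_cong:
  assumes "lin fscale fscale T" "lin fscale fscale T'" "scl V = sA" "scl W = sB" "z \<in> deg (V \<otimes> W) m"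
    and "\<And>k l p q. k + l = m \<Longrightarrow> p \<in> deg V k \<Longrightarrow> q \<in> deg W l \<Longrightarrow> p \<noteq> 0 \<Longrightarrow> q \<noteq> 0 \<Longrightarrow> T (ba q a) = T' (ba q a)"
  shows "HA T z a = HA T' z a"
  by (rule deg_tensor_eqI[OF vector_space_fscale lin_HA lin_HA assms(5)])
    (use assms(6) in \<open>simp add: assms(3,4) HA_ten[OF assms(1)] HA_ten[OF assms(2)]\<close>)

lemma HB_cong:
  assumes "lin fscale fscale T" "lin fscale fscale T'" "scl V = sA" "scl W = sB" "z \<in> deg (V \<otimes> W) m"
    and "\<And>k l p q. k + l = m \<Longrightarrow> p \<in> deg V k \<Longrightarrow> q \<in> deg W l \<Longrightarrow> p \<noteq> 0 \<Longrightarrow> q \<noteq> 0 \<Longrightarrow> T (ba b p) = T' (ba b p)"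
  shows "HB T b z = HB T' b z"
  by (rule deg_tensor_eqI[OF vector_space_fscale lin_HB lin_HB assms(5)])
    (use assms(6) in \<open>simp add: assms(3,4) HB_ten[OF assms(1)] HB_ten[OF assms(2)]\<close>)

text \<open>An argument of degree 0 is a multiple of 1, and the unit conditions evaluate
  \<open>T\<close> there. For \<open>hexA\<close> with unit argument both sides become
  \<open>aa' \<otimes> 1\<close>, \<open>T (b \<otimes> a')\<close> or
  \<open>T (b \<otimes> a)\<close> according to its position; \<open>hexB\<close> is the mirror
  image.\<close>

lemma hexagons_unit:
  assumes T: "lin fscale fscale T" and gr: "graded_upto N T" and un: "unital_upto N T"
    and n: "j + k + l \<le> N" and 0: "j = 0 \<or> k = 0 \<or> l = 0"
  shows "hexA j k l T" "hexB j k l T"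
proof -
  have Tdeg: "T (ba v u) \<in> deg (A \<otimes> B) (s + r)" if "v \<in> deg B s" "u \<in> deg A r" "s + r \<le> N" for u v r s
    using gr ba_deg[OF that(1,2)] that(3) by (auto simp: graded_upto_def)
  note U = unital_uptoD[OF un]
  have scal: "T (ba (sB c b) a) = fscale c (T (ba b a))" "T (ba b (sA c a)) = fscale c (T (ba b a))" for a b c
    by (simp_all add: ten_bilinear linD[OF T])
  show "hexA j k l T"
    unfolding hexA_def
  proof (intro ballI)
    fix b a a' assume b: "b \<in> deg B j" and a: "a \<in> deg A k" and a': "a' \<in> deg A l"
    consider "j = 0" | "k = 0" | "l = 0" using 0 by blast
    then show "T (ba b (a * a')) = HA T (T (ba b a)) a'"
    proof cases
      case 1
      then obtain c where c: "b = sB c 1" using b B.connected by auto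
      have "T (ba 1 (a * a')) = ab (a * a') 1" "T (ba 1 a) = ab a 1" "T (ba 1 a') = ab a' 1"
        using n by (intro U(1)[of "k + l"] U(1)[of k] U(1)[of l] A.mult_deg a a'; simp)+
      then show ?thesis by (simp add: c scal linD[OF lin_HA] HA_ten[OF T])
    next
      case 2
      then obtain c where c: "a = sA c 1" using a A.connected by auto
      have "T (ba b 1) = ab 1 b" using n by (intro U(2)[OF _ b]) simp
      moreover have "lm 1 (T (ba b a')) = T (ba b a')"
        using n by (intro lm_1[OF Tdeg[OF b a']]) simp
      ultimately show ?thesis
        by (simp add: c A.scl_mult_left scal linD[OF lin_HA] HA_ten[OF T])
    next
      case 3
      then obtain c where c: "a' = sA c 1" using a' A.connected by auto
      have "HA T (T (ba b a)) (sA c 1) = fscale c (T (ba b a))"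
      proof (rule AB_eqI[OF Tdeg[OF b a] lin_HA])
        show "j + k \<le> N" using n by simp
        show "lin fscale fscale (fscale c)"
          by (rule linI) (simp_all add: free.scale_right_distrib mult.commute)
        fix k' l' p q assume "k' + l' = j + k" "q \<in> deg B l'"
        then have "T (ba q 1) = ab 1 q" using n by (intro U(2)[of l']) simp_all
        then show "HA T (ab p q) (sA c 1) = fscale c (ab p q)"
          by (simp add: HA_ten[OF T] scal linD[OF lin_lm])
      qed
      then show ?thesis by (simp add: c A.scl_mult_right scal)
    qed
  qed
  show "hexB j k l T"
    unfolding hexB_def
  proof (intro ballI)
    fix b b' a assume b: "b \<in> deg B j" and b': "b' \<in> deg B k" and a: "a \<in> deg A l"
    consider "l = 0" | "k = 0" | "j = 0" using 0 by blast
    then show "T (ba (b * b') a) = HB T b (T (ba b' a))"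
    proof cases
      case 1
      then obtain c where c: "a = sA c 1" using a A.connected by auto
      have "T (ba (b * b') 1) = ab 1 (b * b')" "T (ba b 1) = ab 1 b" "T (ba b' 1) = ab 1 b'"
        using n by (intro U(2)[of "j + k"] U(2)[of j] U(2)[of k] B.mult_deg b b'; simp)+
      then show ?thesis by (simp add: c scal linD[OF lin_HB] HB_ten[OF T])
    next
      case 2
      then obtain c where c: "b' = sB c 1" using b' B.connected by auto
      have "T (ba 1 a) = ab a 1" using n by (intro U(1)[OF _ a]) simp
      moreover have "rm 1 (T (ba b a)) = T (ba b a)"
        using n by (intro rm_1[OF Tdeg[OF b a]]) simp
      ultimately show ?thesis
        by (simp add: c B.scl_mult_right scal linD[OF lin_HB] HB_ten[OF T])
    next
      case 3
      then obtain c where c: "b = sB c 1" using b B.connected by auto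
      have "HB T (sB c 1) (T (ba b' a)) = fscale c (T (ba b' a))"
      proof (rule AB_eqI[OF Tdeg[OF b' a] lin_HB])
        show "k + l \<le> N" using n by simp
        show "lin fscale fscale (fscale c)"
          by (rule linI) (simp_all add: free.scale_right_distrib mult.commute)
        fix k' l' p q assume "k' + l' = k + l" "p \<in> deg A k'"
        then have "T (ba 1 p) = ab p 1" using n by (intro U(1)[of k']) simp_all
        then show "HB T (sB c 1) (ab p q) = fscale c (ab p q)"
          by (simp add: HB_ten[OF T] scal linD[OF lin_rm])
      qed
      then show ?thesis by (simp add: c B.scl_mult_left scal)
    qed
  qed
qed

text \<open>The reduction to linear algebra: the values of \<open>T'\<close> in degree n + 1 enter
  through \<delta>, while R is assembled from the old map \<open>T\<close>.\<close>

lemma hexagons_Suc_iff: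
  assumes T: "lin fscale fscale T" and gr: "graded_upto n T" and hex: "hexagons_upto n T"
    and T': "lin fscale fscale T'" and gr': "graded_upto (Suc n) T'" and un': "unital_upto (Suc n) T'"
    and agree: "\<And>i z. i \<le> n \<Longrightarrow> z \<in> deg (B \<otimes> A) i \<Longrightarrow> T' z = T z"
  shows "hexagons_upto (Suc n) T' \<longleftrightarrow>
    (\<forall>x\<in>deg (pos B \<otimes> pos A \<otimes> pos A) (Suc n). T' (delta1 T x) = R1 T x) \<and>
    (\<forall>y\<in>deg (pos B \<otimes> pos B \<otimes> pos A) (Suc n). T' (delta2 T y) = R2 T y)"
proof -
  have gr'D: "T' (ba v u) \<in> deg (A \<otimes> B) (s + r)" if "v \<in> deg B s" "u \<in> deg A r" "s + r \<le> Suc n" for u v r s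
    using gr' ba_deg[OF that(1,2)] that(3) by (auto simp: graded_upto_def)
  have agree': "T' (ba v u) = T (ba v u)" if "v \<in> deg B s" "u \<in> deg A r" "s + r \<le> n" for u v r s
    using agree ba_deg[OF that(1,2)] that(3) by auto
  \<comment> \<open>With \<open>l > 0\<close> the value \<open>T (b \<otimes> a)\<close> is old.
    Splitting off its part \<open>1 \<otimes> t^B(b \<otimes> a)\<close> leaves \<open>R1\<close>,
    and the part itself contributes \<open>T' (t^B(b \<otimes> a) \<otimes> a')\<close>, the term
    subtracted in \<open>delta1\<close>.\<close>
  have key1: "T' (delta1 T (ten sB fscale b (ten sA sA a a'))) = R1 T (ten sB fscale b (ten sA sA a a')) \<longleftrightarrow>
      T' (ba b (a * a')) = HA T' (T' (ba b a)) a'"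
    if jkl: "j + k + l = Suc n" "l > 0" and d: "b \<in> deg B j" "a \<in> deg A k" "a' \<in> deg A l" for j k l b a a'
  proof -
    let ?z = "T (ba b a)"
    have jk: "j + k \<le> n" using jkl by simp
    have z: "?z \<in> deg (A \<otimes> B) (j + k)" using gr ba_deg[OF d(1,2)] jk by (auto simp: graded_upto_def)
    have "HA T (?z - ab 1 (pB ?z)) a' = HA T' (?z - ab 1 (pB ?z)) a'"
    proof (rule HA_cong[OF T T' _ _ minus_pB_deg[OF z]])
      fix k' l' p q assume *: "k' + l' = j + k" "p \<in> deg (pos A) k'" "q \<in> deg B l'" "p \<noteq> 0"
      then have "k' > 0" by (cases k') (auto simp: deg_pos)
      then show "T (ba q a') = T' (ba q a')" using * jkl by (intro agree'[OF _ d(3), symmetric]) auto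
    qed simp_all
    also have "\<dots> = HA T' ?z a' - T' (ba (pB ?z) a')"
      using lm_1[OF gr'D[OF pB_deg[OF z] d(3)]] jkl by (simp add: linD[OF lin_HA] HA_ten[OF T'])
    finally show ?thesis
      using R1_ten[OF T gr jk _ d] jkl agree'[OF d(1,2) jk]
      by (simp add: delta1_ten[OF T gr] linD[OF T'])
  qed
  have key2: "T' (delta2 T (ten sB fscale b' (ten sB sA b a))) = R2 T (ten sB fscale b' (ten sB sA b a)) \<longleftrightarrow>
      T' (ba (b' * b) a) = HB T' b' (T' (ba b a))"
    if jkl: "j + k + l = Suc n" "j > 0" and d: "b' \<in> deg B j" "b \<in> deg B k" "a \<in> deg A l" for j k l b b' a
  proof -
    let ?z = "T (ba b a)"
    have kl: "k + l \<le> n" using jkl by simp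
    have z: "?z \<in> deg (A \<otimes> B) (k + l)" using gr ba_deg[OF d(2,3)] kl by (auto simp: graded_upto_def)
    have "HB T b' (?z - ab (pA ?z) 1) = HB T' b' (?z - ab (pA ?z) 1)"
    proof (rule HB_cong[OF T T' _ _ minus_pA_deg[OF z]])
      fix k' l' p q assume *: "k' + l' = k + l" "p \<in> deg A k'" "q \<in> deg (pos B) l'" "q \<noteq> 0"
      then have "l' > 0" by (cases l') (auto simp: deg_pos)
      then show "T (ba b' p) = T' (ba b' p)" using * jkl by (intro agree'[OF d(1), symmetric]) auto
    qed simp_all
    also have "\<dots> = HB T' b' ?z - T' (ba b' (pA ?z))"
      using rm_1[OF gr'D[OF d(1) pA_deg[OF z]]] jkl by (simp add: linD[OF lin_HB] HB_ten[OF T'])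
    finally show ?thesis
      using R2_ten[OF T gr kl _ d] jkl agree'[OF d(2,3) kl]
      by (simp add: delta2_ten[OF T gr] linD[OF T'])
  qed
  \<comment> \<open>Below degree n + 1 the hexagons carry over from \<open>T\<close>, since all
    values occurring in them are old.\<close>
  have low: "hexA j k l T'" "hexB j k l T'" if n: "j + k + l \<le> n" for j k l
  proof -
    have h: "hexA j k l T" "hexB j k l T" using hex n by (auto simp: hexagons_upto_def)
    show "hexA j k l T'"
      unfolding hexA_def
    proof (intro ballI)
      fix b a a' assume d: "b \<in> deg B j" "a \<in> deg A k" "a' \<in> deg A l"
      have z: "T (ba b a) \<in> deg (A \<otimes> B) (j + k)"
        using gr ba_deg[OF d(1,2)] n by (auto simp: graded_upto_def)
      have "HA T (T (ba b a)) a' = HA T' (T (ba b a)) a'"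
        by (rule HA_cong[OF T T' refl refl z]) (use agree'[OF _ d(3)] n in auto)
      then show "T' (ba b (a * a')) = HA T' (T' (ba b a)) a'"
        using h(1) d n agree'[OF d(1,2)] agree'[OF d(1) A.mult_deg[OF d(2,3)]]
        by (simp add: hexA_def)
    qed
    show "hexB j k l T'"
      unfolding hexB_def
    proof (intro ballI)
      fix b b' a assume d: "b \<in> deg B j" "b' \<in> deg B k" "a \<in> deg A l"
      have z: "T (ba b' a) \<in> deg (A \<otimes> B) (k + l)"
        using gr ba_deg[OF d(2,3)] n by (auto simp: graded_upto_def)
      have "HB T b (T (ba b' a)) = HB T' b (T (ba b' a))"
        by (rule HB_cong[OF T T' refl refl z]) (use agree'[OF d(1)] n in auto)
      then show "T' (ba (b * b') a) = HB T' b (T' (ba b' a))"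
        using h(2) d n agree'[OF d(2,3)] agree'[OF B.mult_deg[OF d(1,2)] d(3)]
        by (simp add: hexB_def)
    qed
  qed
  show ?thesis
  proof (intro iffI conjI ballI)
    fix x assume hex': "hexagons_upto (Suc n) T'" and x: "x \<in> deg (pos B \<otimes> pos A \<otimes> pos A) (Suc n)"
    have L: "lin fscale fscale (\<lambda>x. T' (delta1 T x))" by (rule lin_comp[OF T' lin_delta1])
    show "T' (delta1 T x) = R1 T x"
    proof (rule deg_tensor_eqI[OF vector_space_fscale L lin_R1 x], unfold scl_simps)
      fix k l b y assume kl: "k + l = Suc n" and b: "b \<in> deg (pos B) k" "b \<noteq> 0" and y: "y \<in> deg (pos A \<otimes> pos A) l"
      show "T' (delta1 T (ten sB fscale b y)) = R1 T (ten sB fscale b y)"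
      proof (rule deg_tensor_eqI[OF vector_space_fscale lin_comp[OF L lin_ten(2)[OF lin_id]]
          lin_comp[OF lin_R1 lin_ten(2)[OF lin_id]] y], unfold scl_simps)
        fix i j a a' assume ij: "i + j = l" and a: "a \<in> deg (pos A) i" "a' \<in> deg (pos A) j" "a \<noteq> 0" "a' \<noteq> 0"
        have d: "j > 0" "b \<in> deg B k" "a \<in> deg A i" "a' \<in> deg A j"
          using a b by (auto simp: deg_pos split: if_splits)
        have "hexA k i j T'" using hex' kl ij by (simp add: hexagons_upto_def)
        then show "T' (delta1 T (ten sB fscale b (ten sA sA a a'))) = R1 T (ten sB fscale b (ten sA sA a a'))"
          using key1[OF _ d] kl ij d by (simp add: hexA_def)
      qed
    qed
  next
    fix x assume hex': "hexagons_upto (Suc n) T'" and x: "x \<in> deg (pos B \<otimes> pos B \<otimes> pos A) (Suc n)"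
    have L: "lin fscale fscale (\<lambda>x. T' (delta2 T x))" by (rule lin_comp[OF T' lin_delta2])
    show "T' (delta2 T x) = R2 T x"
    proof (rule deg_tensor_eqI[OF vector_space_fscale L lin_R2 x], unfold scl_simps)
      fix k l b' y assume kl: "k + l = Suc n" and b': "b' \<in> deg (pos B) k" "b' \<noteq> 0" and y: "y \<in> deg (pos B \<otimes> pos A) l"
      show "T' (delta2 T (ten sB fscale b' y)) = R2 T (ten sB fscale b' y)"
      proof (rule deg_tensor_eqI[OF vector_space_fscale lin_comp[OF L lin_ten(2)[OF lin_id]]
          lin_comp[OF lin_R2 lin_ten(2)[OF lin_id]] y], unfold scl_simps)
        fix i j b a assume ij: "i + j = l" and ba: "b \<in> deg (pos B) i" "a \<in> deg (pos A) j" "b \<noteq> 0" "a \<noteq> 0"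
        have d: "k > 0" "b' \<in> deg B k" "b \<in> deg B i" "a \<in> deg A j"
          using ba b' by (auto simp: deg_pos split: if_splits)
        have "hexB k i j T'" using hex' kl ij by (simp add: hexagons_upto_def)
        then show "T' (delta2 T (ten sB fscale b' (ten sB sA b a))) = R2 T (ten sB fscale b' (ten sB sA b a))"
          using key2[OF _ d] kl ij d by (simp add: hexB_def)
      qed
    qed
  next
    assume *: "(\<forall>x\<in>deg (pos B \<otimes> pos A \<otimes> pos A) (Suc n). T' (delta1 T x) = R1 T x) \<and>
      (\<forall>y\<in>deg (pos B \<otimes> pos B \<otimes> pos A) (Suc n). T' (delta2 T y) = R2 T y)"
    show "hexagons_upto (Suc n) T'"
      unfolding hexagons_upto_def
    proof (intro allI impI)
      fix j k l assume jkl: "j + k + l \<le> Suc n"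
      \<comment> \<open>Scalar arguments are settled by the unit conditions and low degrees by
        \<open>low\<close>; only the third case uses the equations for \<delta> and R.\<close>
      consider "j = 0 \<or> k = 0 \<or> l = 0" | "j + k + l \<le> n" | "j > 0" "k > 0" "l > 0" "j + k + l = Suc n"
        using jkl by linarith
      then show "hexA j k l T' \<and> hexB j k l T'"
      proof cases
        case 1
        then show ?thesis using hexagons_unit[OF T' gr' un' jkl] by simp
      next
        case 2
        then show ?thesis using low by simp
      next
        case 3
        have pd: "x \<in> deg (pos V) i" if "x \<in> deg V i" "i > 0" for V :: "('k, 'v::zero) gspace" and x i
          using that by (simp add: deg_pos)
        have "T' (ba b (a * a')) = HA T' (T' (ba b a)) a'"
          if d: "b \<in> deg B j" "a \<in> deg A k" "a' \<in> deg A l" for b a a'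
        proof -
          have "ten sB fscale b (ten sA sA a a') \<in> deg (pos B \<otimes> pos A \<otimes> pos A) (j + (k + l))"
            using d 3 by (intro ten_in_deg pd) simp_all
          then show ?thesis using * key1[OF 3(4,3) d] 3 by (simp add: add.assoc)
        qed
        moreover have "T' (ba (b' * b) a) = HB T' b' (T' (ba b a))"
          if d: "b' \<in> deg B j" "b \<in> deg B k" "a \<in> deg A l" for b' b a
        proof -
          have "ten sB fscale b' (ten sB sA b a) \<in> deg (pos B \<otimes> pos B \<otimes> pos A) (j + (k + l))"
            using d 3 by (intro ten_in_deg pd) simp_all
          then show ?thesis using * key2[OF 3(4,1) d] 3 by (simp add: add.assoc)
        qed
        ultimately show ?thesis by (simp add: hexA_def hexB_def)
      qed
    qed
  qed
qed

text \<open>\<open>B \<otimes> A\<close> is the direct sum of its bidegree parts, so a map may be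
  prescribed on each part independently. In total degree n + 1 the parts with a factor of degree 0
  are dictated by the unit conditions, all others by \<open>F\<close>.\<close>

lemma extension_exists:
  assumes T: "lin fscale fscale T" and gr: "graded_upto n T" and un: "unital_upto n T"
    and F: "lin fscale fscale F" "\<And>z. z \<in> deg (pos B \<otimes> pos A) (Suc n) \<Longrightarrow> F z \<in> deg (A \<otimes> B) (Suc n)"
  obtains T' where "lin fscale fscale T'" "graded_upto (Suc n) T'" "unital_upto (Suc n) T'"
    "\<And>i z. i \<le> n \<Longrightarrow> z \<in> deg (B \<otimes> A) i \<Longrightarrow> T' z = T z"
    "\<And>z. z \<in> deg (pos B \<otimes> pos A) (Suc n) \<Longrightarrow> T' z = F z"
proof -
  \<comment> \<open>On scalars the flip \<open>ab a b\<close> is the linear form of the unit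
    conditions. Total degrees above n + 1 receive some value as well, which is irrelevant.\<close>
  define G where "G j k b a = (if j + k \<le> n then T (ba b a)
    else if j = 0 \<or> k = 0 then ab a b else F (ba b a))" for j k b a
  \<comment> \<open>Both sums run up to n + 1 inclusive, because one factor alone may carry the
    whole degree.\<close>
  define g where "g b a = (\<Sum>j\<le>Suc n. \<Sum>k\<le>Suc n. G j k (B.component j b) (A.component k a))" for b a
  define T' where "T' = blift fscale g"
  have G: "lin sB fscale (\<lambda>b. G j k b a)" "lin sA fscale (G j k b)" for j k a b
    unfolding G_def[abs_def]
    by (cases "j + k \<le> n"; cases "j = 0 \<or> k = 0";
        simp add: lin_comp[OF T] lin_comp[OF F(1)] lin_ten lin_id)+
  have "bilin sB sA fscale g"
    unfolding g_def
    by (intro bilinI lin_setsum vector_space_fscale lin_comp[OF G(1) B.lin_component] lin_comp[OF G(2) A.lin_component])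
  then have T'_ba: "T' (ba b a) = g b a" for b a
    unfolding T'_def by (rule blift_ten[OF vector_space_fscale])
  have T'_deg: "T' (ba b a) = G j k b a" if "b \<in> deg B j" "a \<in> deg A k" "j + k \<le> Suc n" for b a j k
  proof -
    have "g b a = (\<Sum>j'\<le>Suc n. \<Sum>k'\<le>Suc n. if j' = j then (if k' = k then G j k b a else 0) else 0)"
      unfolding g_def
      by (intro sum.cong refl)
        (auto simp: B.component_of_deg[OF that(1)] A.component_of_deg[OF that(2)] linD(3)[OF G(1)] linD(3)[OF G(2)])
    also have "\<dots> = (\<Sum>j'\<le>Suc n. if j' = j then G j k b a else 0)"
      using that(3) by (intro sum.cong refl) (simp add: sum.delta)
    also have "\<dots> = G j k b a" using that(3) by (simp add: sum.delta)
    finally show ?thesis by (simp add: T'_ba)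
  qed
  have linT': "lin fscale fscale T'" unfolding T'_def by (rule lin_blift[OF vector_space_fscale])
  have agree: "T' z = T z" if "i \<le> n" "z \<in> deg (B \<otimes> A) i" for i z
    by (rule deg_tensor_eqI[OF vector_space_fscale linT' T that(2)]) (use that(1) in \<open>auto simp: T'_deg G_def\<close>)
  show ?thesis
  proof (rule that)
    show "lin fscale fscale T'" by (rule linT')
    show "T' z = T z" if "i \<le> n" "z \<in> deg (B \<otimes> A) i" for i z by (rule agree[OF that])
    show "T' z = F z" if "z \<in> deg (pos B \<otimes> pos A) (Suc n)" for z
      by (rule deg_tensor_eqI[OF vector_space_fscale linT' F(1) that])
        (auto simp: T'_deg G_def deg_pos split: if_splits)
    show "unital_upto (Suc n) T'"
      unfolding unital_upto_def
    proof (intro allI impI ballI conjI)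
      fix i a assume i: "i \<le> Suc n" and a: "a \<in> deg A i"
      show "T' (ba 1 a) = ab a 1"
        using T'_deg[OF B.one_deg a] i unital_uptoD(1)[OF un _ a] by (simp add: G_def)
    next
      fix i b assume i: "i \<le> Suc n" and b: "b \<in> deg B i"
      show "T' (ba b 1) = ab 1 b"
        using T'_deg[OF b A.one_deg] i unital_uptoD(2)[OF un _ b] by (simp add: G_def)
    qed
    show "graded_upto (Suc n) T'"
      unfolding graded_upto_def
    proof (intro allI impI ballI)
      fix i z assume i: "i \<le> Suc n" and z: "z \<in> deg (B \<otimes> A) i"
      show "T' z \<in> deg (A \<otimes> B) i"
      proof (cases "i \<le> n")
        case True
        then show ?thesis using agree[OF True z] gr z by (simp add: graded_upto_def)
      next
        case False
        with i have i: "i = Suc n" by simp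
        show ?thesis
        proof (rule deg_tensor_induct[OF vector_space_fscale linT' subspace_deg_tensor z])
          fix j k b a assume *: "j + k = i" "b \<in> deg B j" "a \<in> deg A k"
          have "G j k b a \<in> deg (A \<otimes> B) (Suc n)"
          proof (cases "j = 0 \<or> k = 0")
            case True
            then show ?thesis using ab_deg[OF *(3,2)] * i by (auto simp: G_def add.commute)
          next
            case False
            then have "ba b a \<in> deg (pos B \<otimes> pos A) (j + k)"
              using * by (intro ten_in_deg) (simp_all add: deg_pos)
            then show ?thesis using F(2) * i False by (simp add: G_def)
          qed
          then show "T' (ba b a) \<in> deg (A \<otimes> B) i" using T'_deg[OF *(2,3)] * i by simp
        qed
      qed
    qed
  qed
qed


text \<open>The flip copies \<open>B \<otimes> A\<close> into \<open>A \<otimes> B\<close> degree by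
  degree, with \<open>unswap\<close> as left inverse. Its injectivity makes a perturbation by
  \<open>swap\<close> visible in the uniqueness argument.\<close>

definition swap where "swap = blift fscale (\<lambda>b a. ab a b)"
definition unswap where "unswap = blift fscale (\<lambda>a b. ba b a)"

lemma lin_swap: "lin fscale fscale swap" "lin fscale fscale unswap"
  unfolding swap_def unswap_def by (rule lin_blift[OF vector_space_fscale])+

lemma swap_ten [simp]: "swap (ba b a) = ab a b" "unswap (ab a b) = ba b a"
  unfolding swap_def unswap_def
  by (rule blift_ten[OF vector_space_fscale], intro bilinI lin_ten lin_id)+

lemma swap_deg: "z \<in> deg (B \<otimes> A) m \<Longrightarrow> swap z \<in> deg (A \<otimes> B) m"
  by (rule deg_tensor_induct[OF vector_space_fscale lin_swap(1) subspace_deg_tensor])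
    (use ab_deg in \<open>force simp: add.commute\<close>)+

lemma unswap_swap:
  assumes "z \<in> deg (B \<otimes> A) m" shows "unswap (swap z) = z"
  by (rule deg_tensor_eqI[OF vector_space_fscale lin_comp[OF lin_swap(2,1)] lin_id assms]) simp

end

theorem lemma3p1:
  fixes A :: "('k::field, 'a::ring_1) gspace"
    and B :: "('k, 'b::ring_1) gspace"
    and n :: nat
    and t :: "(('b \<times> 'a) \<Rightarrow>\<^sub>0 'k) \<Rightarrow> (('a \<times> 'b) \<Rightarrow>\<^sub>0 'k)"
  assumes "connected_graded_algebra A"
    and "connected_graded_algebra B"
    and "graded_twisting A B n t"
  shows "((\<exists>t'. twisting_extension A B n t t') \<longleftrightarrow>
      (\<exists>f. linear_on fscale fscale (deg (pos B \<otimes> pos A) (Suc n)) f \<and>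
           f ` deg (pos B \<otimes> pos A) (Suc n) \<subseteq> deg (A \<otimes> B) (Suc n) \<and>
           (\<forall>x\<in>delta_domain A B (Suc n). f (delta A B n t x) = Rmap A B n t x)))
    \<and> ((\<exists>t'. twisting_extension A B n t t') \<longrightarrow>
      ((\<forall>t1 t2. twisting_extension A B n t t1 \<longrightarrow> twisting_extension A B n t t2 \<longrightarrow>
           (\<forall>x\<in>carrier (trunc (Suc n) (B \<otimes> A)). t1 x = t2 x)) \<longleftrightarrow>
       delta A B n t ` delta_domain A B (Suc n) = deg (pos B \<otimes> pos A) (Suc n)))"
proof -
  note t = assms(3)
  interpret algebra_pair A B
    using assms(1,2) by (simp add: algebra_pair_def)
  let ?P = "deg (pos B \<otimes> pos A) (Suc n)" and ?dd = "delta_domain A B (Suc n)"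
  let ?X = "deg (pos B \<otimes> pos A \<otimes> pos A) (Suc n)" and ?Y = "deg (pos B \<otimes> pos B \<otimes> pos A) (Suc n)"
  let ?ext = "twisting_extension A B n t"

  \<comment> \<open>Reduction to total linear maps\<close>
  have subC: "free.subspace (carrier (trunc m (B \<otimes> A)))" for m
    using subspace_carrier[of "trunc m (B \<otimes> A)"] by (simp add: vector_space_fscale)
  have degC: "z \<in> carrier (trunc m (B \<otimes> A))" if "z \<in> deg (B \<otimes> A) i" "i \<le> m" for z i m
    by (rule deg_carrier[of _ _ i]) (use that in \<open>simp_all add: vector_space_fscale deg_trunc\<close>)
  have P_BA: "z \<in> deg (B \<otimes> A) (Suc n)" if "z \<in> ?P" for z
    by (rule deg_tensor_mono[OF that]) (auto simp: deg_pos split: if_splits)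
  have carr_eq: "L z = M z" if "lin fscale fscale L" "lin fscale fscale M" "z \<in> carrier (trunc m (B \<otimes> A))"
    "\<And>i z. i \<le> m \<Longrightarrow> z \<in> deg (B \<otimes> A) i \<Longrightarrow> L z = M z" for L M z m
    by (rule carrier_eqI[OF _ _ _ vector_space_fscale that(3)])
      (use that in \<open>auto simp: vector_space_fscale deg_trunc linD(3) split: if_splits\<close>)
  have total: "\<exists>T. lin fscale fscale T \<and> (\<forall>x\<in>carrier (trunc m (B \<otimes> A)). s x = T x)"
    if "graded_twisting A B m s" for m s
  proof -
    have "linear_on fscale fscale (carrier (trunc m (B \<otimes> A))) s"
      using that by (simp add: graded_twisting_def graded_linear_def)
    from linear_on_extend[OF vector_space_fscale subC this] show ?thesis by metis
  qed
  obtain T where T: "lin fscale fscale T" and tT: "\<And>x. x \<in> carrier (trunc n (B \<otimes> A)) \<Longrightarrow> t x = T x"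
    using total[OF t] by blast
  have tw: "graded_upto n T" "unital_upto n T" "hexagons_upto n T"
    using t graded_twisting_iff[OF T, of n t] tT by auto
  have dR: "delta A B n t (x, y) = delta1 T x + delta2 T y" "Rmap A B n t (x, y) = R1 T x + R2 T y"
    if "x \<in> ?X" "y \<in> ?Y" for x y
    using delta_Rmap_eq[OF T tw(1) tT that] by auto
  \<comment> \<open>For total maps the hexagons in degree n + 1 are traded for the linear equation
    with \<delta> and R; \<open>ext_iff\<close> justifies this.\<close>
  define is_ext where "is_ext T' \<longleftrightarrow> lin fscale fscale T' \<and> graded_upto (Suc n) T' \<and> unital_upto (Suc n) T' \<and>
    (\<forall>i\<le>n. \<forall>z\<in>deg (B \<otimes> A) i. T' z = T z) \<and> (\<forall>x\<in>?dd. T' (delta A B n t x) = Rmap A B n t x)" for T'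
  have dd_iff: "(\<forall>x\<in>?dd. T' (delta A B n t x) = Rmap A B n t x) \<longleftrightarrow>
      (\<forall>x\<in>?X. T' (delta1 T x) = R1 T x) \<and> (\<forall>y\<in>?Y. T' (delta2 T y) = R2 T y)"
    if T': "lin fscale fscale T'" for T'
  proof -
    \<comment> \<open>Pairs with one zero entry separate the equation on the direct sum into one
      equation per summand.\<close>
    have 0: "0 \<in> ?X" "0 \<in> ?Y" by (simp_all add: free.subspace_0[OF subspace_deg_tensor])
    have "(\<forall>x\<in>?dd. T' (delta A B n t x) = Rmap A B n t x) \<longleftrightarrow>
        (\<forall>x\<in>?X. \<forall>y\<in>?Y. T' (delta1 T x) + T' (delta2 T y) = R1 T x + R2 T y)"
      unfolding delta_domain_def by (simp add: dR linD[OF T'])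
    also have "\<dots> \<longleftrightarrow> (\<forall>x\<in>?X. T' (delta1 T x) = R1 T x) \<and> (\<forall>y\<in>?Y. T' (delta2 T y) = R2 T y)"
      using 0 linD(3)[OF T'] linD(3)[OF lin_delta1] linD(3)[OF lin_delta2] linD(3)[OF lin_R1] linD(3)[OF lin_R2]
      by (metis add.right_neutral add.left_neutral)
    finally show ?thesis .
  qed
  have ext_iff: "?ext t' \<longleftrightarrow> is_ext T'"
    if T': "lin fscale fscale T'" and eq: "\<And>x. x \<in> carrier (trunc (Suc n) (B \<otimes> A)) \<Longrightarrow> t' x = T' x" for t' T'
  proof -
    have sub: "carrier (trunc n (B \<otimes> A)) \<subseteq> carrier (trunc (Suc n) (B \<otimes> A))"
      by (rule carrier_trunc_mono[OF vector_space_gtensor]) simp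
    have "(\<forall>x\<in>carrier (trunc n (B \<otimes> A)). t' x = t x) \<longleftrightarrow> (\<forall>x\<in>carrier (trunc n (B \<otimes> A)). T' x = T x)"
      using sub eq tT by (metis subsetD)
    also have "\<dots> \<longleftrightarrow> (\<forall>i\<le>n. \<forall>z\<in>deg (B \<otimes> A) i. T' z = T z)"
      using degC carr_eq[OF T' T] by blast
    finally have agree: "(\<forall>x\<in>carrier (trunc n (B \<otimes> A)). t' x = t x) \<longleftrightarrow> (\<forall>i\<le>n. \<forall>z\<in>deg (B \<otimes> A) i. T' z = T z)" .
    have "hexagons_upto (Suc n) T' \<longleftrightarrow> (\<forall>x\<in>?dd. T' (delta A B n t x) = Rmap A B n t x)"
      if "graded_upto (Suc n) T'" "unital_upto (Suc n) T'" "\<forall>i\<le>n. \<forall>z\<in>deg (B \<otimes> A) i. T' z = T z"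
      unfolding dd_iff[OF T'] by (rule hexagons_Suc_iff[OF T tw(1,3) T' that(1,2)]) (use that(3) in simp)
    moreover have "graded_twisting A B (Suc n) t' \<longleftrightarrow>
        graded_upto (Suc n) T' \<and> unital_upto (Suc n) T' \<and> hexagons_upto (Suc n) T'"
      by (rule graded_twisting_iff[OF T']) (rule eq)
    ultimately show ?thesis
      unfolding twisting_extension_def is_ext_def agree using T' by argo
  qed
  have is_ext_ext: "?ext T'" if "is_ext T'" for T'
    using ext_iff[of T' T'] that by (simp add: is_ext_def)
  have ext_total: "\<exists>T'. is_ext T' \<and> (\<forall>x\<in>carrier (trunc (Suc n) (B \<otimes> A)). t' x = T' x)" if "?ext t'" for t'
  proof -
    obtain T' where "lin fscale fscale T'" "\<And>x. x \<in> carrier (trunc (Suc n) (B \<otimes> A)) \<Longrightarrow> t' x = T' x"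
      using total[of "Suc n" t'] \<open>?ext t'\<close> by (auto simp: twisting_extension_def)
    then show ?thesis using ext_iff[of T' t'] \<open>?ext t'\<close> by blast
  qed
  have delta_P: "delta A B n t x \<in> ?P" if "x \<in> ?dd" for x
    using that
    by (auto simp: delta_domain_def dR
        intro!: free.subspace_add[OF subspace_deg_tensor] delta1_deg[OF T tw(1)] delta2_deg[OF T tw(1)])
  have from_F: "\<exists>T'. is_ext T' \<and> (\<forall>z\<in>?P. T' z = F z)"
    if F: "lin fscale fscale F" "\<And>z. z \<in> ?P \<Longrightarrow> F z \<in> deg (A \<otimes> B) (Suc n)"
      "\<And>x. x \<in> ?dd \<Longrightarrow> F (delta A B n t x) = Rmap A B n t x" for F
  proof -
    obtain T' where "lin fscale fscale T'" "graded_upto (Suc n) T'" "unital_upto (Suc n) T'"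
      "\<And>i z. i \<le> n \<Longrightarrow> z \<in> deg (B \<otimes> A) i \<Longrightarrow> T' z = T z" "\<And>z. z \<in> ?P \<Longrightarrow> T' z = F z"
      using extension_exists[OF T tw(1,2) F(1,2)] by blast
    then show ?thesis using F(3) delta_P by (intro exI[of _ T']) (auto simp: is_ext_def)
  qed
  have ext_P: "T' z \<in> deg (A \<otimes> B) (Suc n)" if "is_ext T'" "z \<in> ?P" for T' z
    using that P_BA by (auto simp: is_ext_def graded_upto_def)
  \<comment> \<open>Splitting by bidegree, the unit conditions and the agreement with
    \<open>T\<close> leave no freedom outside \<open>?P\<close>.\<close>
  have unique: "T1 z = T2 z"
    if T1: "is_ext T1" and T2: "is_ext T2" and P: "\<And>z. z \<in> ?P \<Longrightarrow> T1 z = T2 z"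
      and z: "z \<in> carrier (trunc (Suc n) (B \<otimes> A))" for T1 T2 z
  proof (rule carr_eq[OF _ _ z])
    show lin: "lin fscale fscale T1" "lin fscale fscale T2" using T1 T2 by (auto simp: is_ext_def)
    fix i z assume i: "i \<le> Suc n" and z: "z \<in> deg (B \<otimes> A) i"
    show "T1 z = T2 z"
    proof (rule deg_tensor_eqI[OF vector_space_fscale lin z])
      fix j k b a assume *: "j + k = i" "b \<in> deg B j" "a \<in> deg A k"
      have un: "unital_upto (Suc n) T1" "unital_upto (Suc n) T2" using T1 T2 by (auto simp: is_ext_def)
      consider "j + k \<le> n" | "j = 0" "k = Suc n" | "k = 0" "j = Suc n" | "j > 0" "k > 0" "j + k = Suc n"
        using * i by linarith
      then show "T1 (ba b a) = T2 (ba b a)"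
      proof cases
        case 1
        then show ?thesis using T1 T2 ba_deg[OF *(2,3)] by (auto simp: is_ext_def)
      next
        case 2
        then obtain c where "b = sB c 1" using * B.connected by auto
        then show ?thesis using 2 *(3) unital_uptoD(1)[OF un(1) _ *(3)] unital_uptoD(1)[OF un(2) _ *(3)]
          by (simp add: ten_bilinear linD[OF lin(1)] linD[OF lin(2)])
      next
        case 3
        then obtain c where "a = sA c 1" using * A.connected by auto
        then show ?thesis using 3 *(2) unital_uptoD(2)[OF un(1) _ *(2)] unital_uptoD(2)[OF un(2) _ *(2)]
          by (simp add: ten_bilinear linD[OF lin(1)] linD[OF lin(2)])
      next
        case 4
        then have "ba b a \<in> deg (pos B \<otimes> pos A) (j + k)"
          using * by (intro ten_in_deg) (simp_all add: deg_pos)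
        then show ?thesis using 4 P by simp
      qed
    qed
  qed

  \<comment> \<open>Existence of an extension\<close>
  have exist: "(\<exists>t'. ?ext t') \<longleftrightarrow> (\<exists>f. linear_on fscale fscale ?P f \<and> f ` ?P \<subseteq> deg (A \<otimes> B) (Suc n) \<and>
      (\<forall>x\<in>?dd. f (delta A B n t x) = Rmap A B n t x))"
  proof
    assume "\<exists>t'. ?ext t'"
    then obtain T' where T': "is_ext T'" using ext_total by blast
    then show "\<exists>f. linear_on fscale fscale ?P f \<and> f ` ?P \<subseteq> deg (A \<otimes> B) (Suc n) \<and>
      (\<forall>x\<in>?dd. f (delta A B n t x) = Rmap A B n t x)"
      using ext_P[OF T'] by (intro exI[of _ T']) (auto simp: is_ext_def lin_imp_linear_on)
  next
    assume "\<exists>f. linear_on fscale fscale ?P f \<and> f ` ?P \<subseteq> deg (A \<otimes> B) (Suc n) \<and>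
      (\<forall>x\<in>?dd. f (delta A B n t x) = Rmap A B n t x)"
    then obtain f where f: "linear_on fscale fscale ?P f" "f ` ?P \<subseteq> deg (A \<otimes> B) (Suc n)"
      "\<And>x. x \<in> ?dd \<Longrightarrow> f (delta A B n t x) = Rmap A B n t x" by blast
    \<comment> \<open>Gluing requires a total map, and any linear extension of \<open>f\<close> from
      \<open>?P\<close> serves.\<close>
    obtain F where F: "lin fscale fscale F" "\<And>x. x \<in> ?P \<Longrightarrow> F x = f x"
      using linear_on_extend[OF vector_space_fscale subspace_deg_tensor f(1)] by blast
    have "\<exists>T'. is_ext T' \<and> (\<forall>z\<in>?P. T' z = F z)"
      using f(2,3) by (intro from_F[OF F(1)]) (auto simp: F(2) delta_P image_subset_iff)
    then show "\<exists>t'. ?ext t'" using is_ext_ext by blast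
  qed

  \<comment> \<open>Uniqueness of the extension\<close>
  have "(\<forall>t1 t2. ?ext t1 \<longrightarrow> ?ext t2 \<longrightarrow> (\<forall>x\<in>carrier (trunc (Suc n) (B \<otimes> A)). t1 x = t2 x)) \<longleftrightarrow>
      delta A B n t ` ?dd = ?P" if ex: "\<exists>t'. ?ext t'"
  proof
    assume surj: "delta A B n t ` ?dd = ?P"
    show "\<forall>t1 t2. ?ext t1 \<longrightarrow> ?ext t2 \<longrightarrow> (\<forall>x\<in>carrier (trunc (Suc n) (B \<otimes> A)). t1 x = t2 x)"
    proof (intro allI impI ballI)
      fix t1 t2 x assume "?ext t1" "?ext t2" and x: "x \<in> carrier (trunc (Suc n) (B \<otimes> A))"
      then obtain T1 T2 where T12: "is_ext T1" "is_ext T2" "t1 x = T1 x" "t2 x = T2 x"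
        using ext_total by metis
      \<comment> \<open>By surjectivity \<open>z\<close> is a value of \<delta>, so both maps take
        the prescribed value of R there.\<close>
      have "T1 z = T2 z" if "z \<in> ?P" for z
        using that T12(1,2) unfolding surj[symmetric] by (auto simp: is_ext_def)
      then show "t1 x = t2 x" using unique[OF T12(1,2) _ x] T12(3,4) by simp
    qed
  next
    assume uniq: "\<forall>t1 t2. ?ext t1 \<longrightarrow> ?ext t2 \<longrightarrow> (\<forall>x\<in>carrier (trunc (Suc n) (B \<otimes> A)). t1 x = t2 x)"
    \<comment> \<open>A projection onto the image of \<open>\<delta>\<close> yields a second solution \<open>F\<close> of \<open>F \<delta> = R\<close>, different from \<open>T1\<close> off the image.\<close>
    let ?I = "delta A B n t ` ?dd"
    have subI: "free.subspace ?I"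
    proof (rule free.subspaceI)
      have "(0, 0) \<in> ?dd" by (simp add: delta_domain_def free.subspace_0[OF subspace_deg_tensor])
      then show "0 \<in> ?I"
        by (intro image_eqI[of _ _ "(0, 0)"])
          (simp_all add: delta_domain_def dR linD(3)[OF lin_delta1] linD(3)[OF lin_delta2])
    next
      fix u v assume "u \<in> ?I" "v \<in> ?I"
      then obtain x y x' y' where d: "x \<in> ?X" "y \<in> ?Y" "x' \<in> ?X" "y' \<in> ?Y"
        and uv: "u = delta1 T x + delta2 T y" "v = delta1 T x' + delta2 T y'"
        by (auto simp: delta_domain_def dR)
      have "x + x' \<in> ?X" "y + y' \<in> ?Y" using d by (simp_all add: free.subspace_add[OF subspace_deg_tensor])
      then show "u + v \<in> ?I"
        by (intro image_eqI[of _ _ "(x + x', y + y')"])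
          (simp_all add: delta_domain_def dR uv linD[OF lin_delta1] linD[OF lin_delta2])
    next
      fix c u assume "u \<in> ?I"
      then obtain x y where d: "x \<in> ?X" "y \<in> ?Y" and u: "u = delta1 T x + delta2 T y"
        by (auto simp: delta_domain_def dR)
      have "fscale c x \<in> ?X" "fscale c y \<in> ?Y" using d by (simp_all add: free.subspace_scale[OF subspace_deg_tensor])
      then show "fscale c u \<in> ?I"
        by (intro image_eqI[of _ _ "(fscale c x, fscale c y)"])
          (simp_all add: delta_domain_def dR u free.scale_right_distrib linD[OF lin_delta1] linD[OF lin_delta2])
    qed
    obtain g where g: "lin fscale fscale g" "range g \<subseteq> ?I" "\<And>z. z \<in> ?I \<Longrightarrow> g z = z"
      using projection_exists[OF vector_space_fscale subI] by blast
    obtain T1 where T1: "is_ext T1" using ex ext_total by blast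
    have lin1: "lin fscale fscale T1" using T1 by (simp add: is_ext_def)
    \<comment> \<open>The added term vanishes on \<open>?I\<close>, where \<open>g\<close> is the
      identity, so the equation with R persists. Since \<open>swap\<close> is injective on tensors
      of degree n + 1, \<open>F z = T1 z\<close> with \<open>z\<close> in \<open>?P\<close> forces
      \<open>z = g z\<close>, an element of \<open>?I\<close>.\<close>
    define F where "F z = T1 z + swap (z - g z)" for z
    have gP: "z - g z \<in> ?P" if "z \<in> ?P" for z
    proof -
      obtain x where "x \<in> ?dd" "g z = delta A B n t x"
        using subsetD[OF g(2) rangeI, of z] by (rule imageE)
      then have "g z \<in> ?P" using delta_P by simp
      with that show ?thesis by (rule free.subspace_diff[OF subspace_deg_tensor])
    qed
    have "\<exists>T2. is_ext T2 \<and> (\<forall>z\<in>?P. T2 z = F z)"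
    proof (rule from_F)
      show "lin fscale fscale F"
        unfolding F_def by (intro lin_add lin_diff lin_comp[OF lin_swap(1)] vector_space_fscale lin1 g(1) lin_id)
      show "F z \<in> deg (A \<otimes> B) (Suc n)" if "z \<in> ?P" for z
        unfolding F_def using that
        by (intro free.subspace_add[OF subspace_deg_tensor] ext_P[OF T1] swap_deg P_BA gP)
      show "F (delta A B n t x) = Rmap A B n t x" if "x \<in> ?dd" for x
        using that T1 g(3) by (simp add: F_def is_ext_def linD(3)[OF lin_swap(1)])
    qed
    then obtain T2 where T2: "is_ext T2" "\<And>z. z \<in> ?P \<Longrightarrow> T2 z = F z" by blast
    have "z \<in> ?I" if z: "z \<in> ?P" for z
    proof -
      have "T1 z = T2 z"
        using uniq is_ext_ext[OF T1] is_ext_ext[OF T2(1)] degC[OF P_BA[OF z]] by blast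
      then have "swap (z - g z) = 0" using T2(2)[OF z] by (simp add: F_def)
      then have "z = g z" using unswap_swap[OF P_BA[OF gP[OF z]]] linD(3)[OF lin_swap(2)] by simp
      moreover have "g z \<in> ?I" using subsetD[OF g(2) rangeI] .
      ultimately show ?thesis by simp
    qed
    then show "?I = ?P" using delta_P by (intro equalityI subsetI) (auto simp del: split_paired_All)
  qed
  with exist show ?thesis by blast
qed

end
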